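(* Let $D\ge 2$ be a squarefree integer and $K=\mathbb{Q}(\sqrt{D})$. Assume that one of the following holds: (i) $D\equiv 2,3\pmod 4$ and there exists a ternary $\mathbb{Z}$-universal generalized quadratic form over $K$; (ii) $D\equiv 1\pmod 4$ and there exists a classical ternary $\mathbb{Z}$-universal generalized quadratic form over $K$. Then $D\in\{1,\dots,62\}\cup\{66,70,74,77,78,82,85,86,87,93,94,95,102,106,110\}$.
   Context: $\mathcal{O}_K$ is the ring of integers of $K$ and $\tau: K\to K$, $a+b\sqrt{D}\mapsto a-b\sqrt{D}$. A generalized quadratic form in $n$ variables over $K$ is an expression $G(z_1,\dots,z_n)=\sum_{1\le i\le j\le n}\alpha_{ij}z_iz_j+\sum_{1\le i,j\le n}\beta_{ij}z_i\tau(z_j)+\sum_{1\le i\le j\le n}\gamma_{ij}\tau(z_i)\tau(z_j)$ with coefficients in $K$, evaluated at $\mathbf{a}\in K^n$ by substituting $a_i$ for $z_i$ and $\tau(a_i)$ for $\tau(z_i)$. Ternary means $n=3$. $G$ is integral if all coefficients lie in $\mathcal{O}_K$; classical if integral and $\alpha_{ij},\gamma_{ij}\in2\mathcal{O}_K$ for $i<j$ and $\beta_{ij}\in 2\mathcal{O}_K$ for all $i,j$. $G$ is $\mathbb{Z}$-valued if $G(\mathbf{a})\in\mathbb{Z}$ for all $\mathbf{a}\in\mathcal{O}_K^n$; positive definite if $G(\mathbf{a})>0$ for all nonzero $\mathbf{a}\in K^n$; $\mathbb{Z}$-universal if positive definite, integral, $\mathbb{Z}$-valued, and every positive integer equals $G(\mathbf{a})$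 for some $\mathbf{a}\in\mathcal{O}_K^n$. *)

theory Defs
  imports Complex_Main "HOL-Computational_Algebra.Computational_Algebra" "HOL-Library.FuncSet"
begin

text \<open>
  The field \<open>\<rat>(\<surd>D)\<close> is realised inside the reals. This fixes the embedding with
  \<open>\<surd>D > 0\<close>; the choice is immaterial for positivity of a \<open>\<int>\<close>-valued form, as all
  its values on \<open>K\<^sup>n\<close> are rational.
\<close>

definition quad_field :: "int \<Rightarrow> real set" where
  "quad_field D = {a + b * sqrt (of_int D) | a b. a \<in> \<rat> \<and> b \<in> \<rat>}"

definition quad_int :: "int \<Rightarrow> real set" where
  "quad_int D = {x \<in> quad_field D. algebraic_int x}"

definition quad_conj :: "int \<Rightarrow> real \<Rightarrow> real" where
  "quad_conj D x = (THE y. \<exists>a\<in>\<rat>. \<exists>b\<in>\<rat>.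
     x = a + b * sqrt (of_int D) \<and> y = a - b * sqrt (of_int D))"

lemma sqrt_squarefree_irrational:
  fixes D :: int
  assumes "D \<ge> 2" "squarefree D"
  shows "sqrt (of_int D) \<notin> \<rat>"
proof
  assume rat: "sqrt (of_int D) \<in> \<rat>"
  have "algebraic_int (sqrt (of_int D))"
    by (rule algebraic_int_sqrt) auto
  with rat have "sqrt (of_int D) \<in> \<int>"
    by (intro rational_algebraic_int_is_int)
  then obtain k where k: "sqrt (of_int D) = of_int k"
    by (auto elim: Ints_cases)
  have "real_of_int D = sqrt (of_int D) ^ 2"
    using assms by simp
  then have "real_of_int D = of_int (k ^ 2)"
    by (simp add: k)
  then have D: "D = k ^ 2"
    by (simp only: of_int_eq_iff)
  then have "k dvd 1"
    using squarefreeD[OF assms(2), of k] by simp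
  then have "D = 1"
    by (simp add: D power2_eq_1_iff abs_if split: if_splits)
  with assms(1) show False by simp
qed

lemma quad_conj_eq:
  assumes "D \<ge> 2" "squarefree D" "a \<in> \<rat>" "b \<in> \<rat>"
  shows "quad_conj D (a + b * sqrt (of_int D)) = a - b * sqrt (of_int D)"
proof -
  let ?s = "sqrt (of_int D)"
  have uniq: "a = c \<and> b = d" if "c \<in> \<rat>" "d \<in> \<rat>" and eq: "a + b * ?s = c + d * ?s" for c d
  proof -
    have "b = d"
    proof (rule ccontr)
      assume "b \<noteq> d"
      then have "?s = (c - a) / (b - d)"
        using eq by (simp add: field_simps)
      also have "\<dots> \<in> \<rat>"
        using assms that by (intro Rats_divide Rats_diff)
      finally show False
        using sqrt_squarefree_irrational assms by blast
    qed
    with eq show ?thesis by simp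
  qed
  show ?thesis
    unfolding quad_conj_def
  proof (rule the_equality)
    show "\<exists>c\<in>\<rat>. \<exists>d\<in>\<rat>. a + b * ?s = c + d * ?s \<and> a - b * ?s = c - d * ?s"
      using assms by blast
  next
    fix y
    assume "\<exists>c\<in>\<rat>. \<exists>d\<in>\<rat>. a + b * ?s = c + d * ?s \<and> y = c - d * ?s"
    then show "y = a - b * ?s"
      using uniq by blast
  qed
qed

text \<open>
  A generalized quadratic form in \<open>n\<close> variables is given by its coefficients. Variables are
  indexed by \<open>1, \<dots>, n\<close>; only \<open>gqf_\<alpha> G i j\<close> and \<open>gqf_\<gamma> G i j\<close> with \<open>1 \<le> i \<le> j \<le> n\<close>
  and \<open>gqf_\<beta> G i j\<close> with \<open>1 \<le> i, j \<le> n\<close> are meaningful.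
\<close>

record gqf =
  gqf_\<alpha> :: "nat \<Rightarrow> nat \<Rightarrow> real"
  gqf_\<beta> :: "nat \<Rightarrow> nat \<Rightarrow> real"
  gqf_\<gamma> :: "nat \<Rightarrow> nat \<Rightarrow> real"

definition gqf_coeffs_in :: "real set \<Rightarrow> nat \<Rightarrow> gqf \<Rightarrow> bool" where
  "gqf_coeffs_in R n G \<longleftrightarrow>
     (\<forall>i\<in>{1..n}. \<forall>j\<in>{i..n}. gqf_\<alpha> G i j \<in> R \<and> gqf_\<gamma> G i j \<in> R) \<and>
     (\<forall>i\<in>{1..n}. \<forall>j\<in>{1..n}. gqf_\<beta> G i j \<in> R)"

definition gen_quad_form :: "int \<Rightarrow> nat \<Rightarrow> gqf \<Rightarrow> bool" where
  "gen_quad_form D n G \<longleftrightarrow> gqf_coeffs_in (quad_field D) n G"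

definition gqf_eval :: "int \<Rightarrow> nat \<Rightarrow> gqf \<Rightarrow> (nat \<Rightarrow> real) \<Rightarrow> real" where
  "gqf_eval D n G z =
     (\<Sum>i=1..n. \<Sum>j=i..n. gqf_\<alpha> G i j * z i * z j) +
     (\<Sum>i=1..n. \<Sum>j=1..n. gqf_\<beta> G i j * z i * quad_conj D (z j)) +
     (\<Sum>i=1..n. \<Sum>j=i..n. gqf_\<gamma> G i j * quad_conj D (z i) * quad_conj D (z j))"

definition gqf_integral :: "int \<Rightarrow> nat \<Rightarrow> gqf \<Rightarrow> bool" where
  "gqf_integral D n G \<longleftrightarrow> gqf_coeffs_in (quad_int D) n G"

definition gqf_classical :: "int \<Rightarrow> nat \<Rightarrow> gqf \<Rightarrow> bool" where
  "gqf_classical D n G \<longleftrightarrow> gqf_integral D n G \<and>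
     (\<forall>i\<in>{1..n}. \<forall>j\<in>{i<..n}.
        gqf_\<alpha> G i j \<in> (*) 2 ` quad_int D \<and> gqf_\<gamma> G i j \<in> (*) 2 ` quad_int D) \<and>
     (\<forall>i\<in>{1..n}. \<forall>j\<in>{1..n}. gqf_\<beta> G i j \<in> (*) 2 ` quad_int D)"

definition gqf_Z_valued :: "int \<Rightarrow> nat \<Rightarrow> gqf \<Rightarrow> bool" where
  "gqf_Z_valued D n G \<longleftrightarrow> (\<forall>a \<in> {1..n} \<rightarrow> quad_int D. gqf_eval D n G a \<in> \<int>)"

definition gqf_pos_def :: "int \<Rightarrow> nat \<Rightarrow> gqf \<Rightarrow> bool" where
  "gqf_pos_def D n G \<longleftrightarrow>
     (\<forall>a \<in> {1..n} \<rightarrow> quad_field D. (\<exists>i\<in>{1..n}. a i \<noteq> 0) \<longrightarrow> gqf_eval D n G a > 0)"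

definition gqf_Z_universal :: "int \<Rightarrow> nat \<Rightarrow> gqf \<Rightarrow> bool" where
  "gqf_Z_universal D n G \<longleftrightarrow>
     gqf_pos_def D n G \<and> gqf_integral D n G \<and> gqf_Z_valued D n G \<and>
     (\<forall>m::int. m > 0 \<longrightarrow> (\<exists>a \<in> {1..n} \<rightarrow> quad_int D. gqf_eval D n G a = of_int m))"

end

theory Submission
  imports Defs "HOL-Analysis.Determinants" "HOL-Number_Theory.Cong"
begin

text \<open>
  Restricted to \<open>\<int>\<close>-coordinates, the form becomes a positive definite classical integral
  quadratic form in six variables that represents every positive integer. Modulo \<open>D\<close> the
  multiples of \<open>\<surd>D\<close> lie in the radical of its bilinear form, which therefore has rank at most
  three, so \<open>D\<close> divides the Gram determinant of any four vectors. Escalation as in the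
  15-theorem of Conway, Schneeberger and Bhargava yields vectors \<open>v\<^sub>1, v\<^sub>2, v\<^sub>3\<close> spanning one of
  nine ternary forms, and a fourth vector of norm a number missed by that ternary form. The four
  vectors have a nonzero Gram determinant, which is at most 112 and can be enumerated.
\<close>

subsection \<open>Integers of real quadratic fields\<close>

text \<open>The obstacle is integrality of the bilinear form, not only of its values. Being
  \<int>-valued forces \<gamma>_ij = \<tau>(\<alpha>_ij) and \<beta>_ji = \<tau>(\<beta>_ij), so a
  cross term and its conjugate add up to a trace, and this trace supplies the factor 2 that
  polarization needs. With ring of integers Z[sqrt D] every integral form therefore becomes
  classical over Z. For D = 1 mod 4 coefficients can have denominator 2, which the classical
  hypothesis absorbs; the coordinates have that denominator too, so the argument runs on 4 times the
  form, and 4 is prime to D. What is known of the fourth vector is its norm and its integral inner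
  products with the first three. It is therefore not enough that the ternary form misses the norm at
  integer points: it must also miss it at the rational points whose coordinates come from such inner
  products. The finite searches check this stronger statement.\<close>

lemma sqrt_rat_independent:
  assumes "D \<ge> 2" "squarefree D" "a \<in> \<rat>" "b \<in> \<rat>" "a + b * sqrt (of_int D) = 0"
  shows "a = 0" "b = 0"
proof -
  show "b = 0"
  proof (rule ccontr)
    assume "b \<noteq> 0"
    then have "sqrt (of_int D) = - a / b"
      using assms(5) by (simp add: field_simps)
    also have "\<dots> \<in> \<rat>" using assms by auto
    finally show False using sqrt_squarefree_irrational assms by blast
  qed
  with assms(5) show "a = 0" by simp
qed

lemma poly_of_int_add:
  "poly (map_poly of_int (p + q)) (x::real) = poly (map_poly of_int p) x + poly (map_poly of_int q) x"
proof -
  have "map_poly of_int (p + q) = map_poly of_int p + (map_poly of_int q :: real poly)"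
    by (rule poly_eqI) (simp add: coeff_map_poly)
  then show ?thesis by simp
qed

lemma poly_of_int_smult:
  "poly (map_poly of_int (smult c p)) (x::real) = of_int c * poly (map_poly of_int p) x"
  by (simp add: map_poly_smult)

lemma poly_of_int_pCons:
  "poly (map_poly of_int (pCons c p)) (x::real) = of_int c + x * poly (map_poly of_int p) x"
  by (simp add: map_poly_pCons)

lemma poly_of_int_mult:
  "poly (map_poly of_int (p * q)) (x::real) = poly (map_poly of_int p) x * poly (map_poly of_int q) x"
  by (induction p)
    (simp_all add: mult_pCons_left poly_of_int_add poly_of_int_smult poly_of_int_pCons algebra_simps)

text \<open>
  Gauss's lemma for quadratic irrationals: pseudo-dividing a monic integer polynomial by the
  primitive minimal polynomial of \<open>x\<close> leaves no remainder, and comparing contents shows that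
  the latter has a unit as leading coefficient.
\<close>

lemma algebraic_int_quadratic:
  fixes x t n :: real
  assumes "algebraic_int x" "x \<notin> \<rat>" "t \<in> \<rat>" "n \<in> \<rat>" and root: "x\<^sup>2 - t * x + n = 0"
  shows "t \<in> \<int>" "n \<in> \<int>"
proof -
  let ?e = "\<lambda>p. poly (map_poly of_int p) x"
  obtain p where p: "?e p = 0" "lead_coeff p = 1"
    using assms(1) by (auto simp: algebraic_int_altdef_ipoly)
  obtain u w where t: "t = of_int u / of_int w" "w > 0"
    using assms(3) by (elim Rats_cases')
  obtain v w' where n: "n = of_int v / of_int w'" "w' > 0"
    using assms(4) by (elim Rats_cases')
  define q0 where "q0 = [:v * w, - u * w', w * w':]"
  define q where "q = primitive_part q0"
  define c where "c = content q0"
  have q0: "q0 = smult c q" by (simp add: q_def c_def)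
  have "q0 \<noteq> 0" "degree q0 = 2" using t n by (simp_all add: q0_def)
  then have q: "c \<noteq> 0" "q \<noteq> 0" "degree q = 2" "content q = 1"
    by (simp_all add: q_def c_def)
  have "?e q0 = of_int (w * w') * (x\<^sup>2 - t * x + n)"
  proof -
    have "of_int u = of_int w * t" "of_int v = of_int w' * n" using t n by simp_all
    then have "of_int (w * w') * (x\<^sup>2 - t * x + n) =
        of_int (w * w') * x\<^sup>2 - of_int (u * w') * x + of_int (v * w)"
      by (simp add: algebra_simps)
    then show ?thesis
      by (simp add: q0_def poly_of_int_pCons power2_eq_square algebra_simps)
  qed
  then have "?e q = 0" using root q by (simp add: q0 poly_of_int_smult)
  obtain h r where hr: "pseudo_divmod p q = (h, r)" by fastforce
  define A where "A = lead_coeff q"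
  define k where "k = A ^ (Suc (degree p) - degree q)"
  have "A \<noteq> 0" unfolding A_def using q(2) by (rule leading_coeff_neq_0)
  then have "k \<noteq> 0" by (simp add: k_def)
  have div: "smult k p = q * h + r" "r = 0 \<or> degree r < 2"
    using pseudo_divmod[OF q(2) hr] q by (simp_all add: A_def k_def)
  have "?e (smult k p) = ?e (q * h + r)" by (simp only: div(1))
  then have "?e r = 0"
    unfolding poly_of_int_add poly_of_int_mult poly_of_int_smult using p \<open>?e q = 0\<close> by simp
  \<comment> \<open>A nonzero integer polynomial of degree at most one has no irrational
    root.\<close>
  have "r = 0"
  proof -
    have "degree r \<le> 1" using div(2) by auto
    then have "r = [:coeff r 0, coeff r 1:]"
      by (intro poly_eqI) (auto simp: coeff_pCons coeff_eq_0 split: nat.splits)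
    then obtain r0 r1 where r: "r = [:r0, r1:]" by blast
    then have e: "of_int r0 + x * of_int r1 = 0"
      using \<open>?e r = 0\<close> by (simp add: poly_of_int_pCons)
    have "r1 = 0"
    proof (rule ccontr)
      assume "r1 \<noteq> 0"
      then have "x = - of_int r0 / of_int r1" using e by (simp add: field_simps)
      then show False using assms(2) by auto
    qed
    then show ?thesis using r e by simp
  qed
  then have kp: "smult k p = q * h" using div by simp
  have "content p dvd 1"
    using content_dvd_coeff[of p "degree p"] p(2) by simp
  then have "content p = 1" by (metis is_unit_normalize normalize_content)
  then have "content h = \<bar>k\<bar>"
    using arg_cong[OF kp, of content] q by (simp add: content_mult)
  then have "lead_coeff h = \<bar>k\<bar> * lead_coeff (primitive_part h)"
    by (metis content_times_primitive_part lead_coeff_smult)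
  moreover have "k = A * lead_coeff h"
    using arg_cong[OF kp, of lead_coeff] p(2) \<open>k \<noteq> 0\<close> by (simp add: A_def lead_coeff_mult)
  ultimately have "\<bar>k\<bar> * \<bar>A * lead_coeff (primitive_part h)\<bar> = \<bar>k\<bar> * 1"
    by (metis abs_abs abs_mult mult.left_commute mult.right_neutral)
  then have "\<bar>A * lead_coeff (primitive_part h)\<bar> = 1"
    using \<open>k \<noteq> 0\<close> by simp
  then have "\<bar>A\<bar> = 1"
    by (auto simp: abs_mult zmult_eq_1_iff)
  moreover have "A = coeff q 2" using q by (simp add: A_def)
  ultimately have A: "coeff q 2 = 1 \<or> coeff q 2 = -1" by auto
  have "v * w = c * coeff q 0" "- u * w' = c * coeff q 1" "w * w' = c * coeff q 2"
    using arg_cong[OF q0, of "\<lambda>p. coeff p 0"] arg_cong[OF q0, of "\<lambda>p. coeff p 1"]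
      arg_cong[OF q0, of "\<lambda>p. coeff p 2"]
    by (simp_all add: q0_def numeral_2_eq_2)
  have "c = w * w' * coeff q 2" using A \<open>w * w' = c * coeff q 2\<close> by auto
  then have "w' * u = w' * (- w * (coeff q 2 * coeff q 1))" "w * v = w * (w' * (coeff q 2 * coeff q 0))"
    using \<open>v * w = c * coeff q 0\<close> \<open>- u * w' = c * coeff q 1\<close> by (simp_all add: algebra_simps)
  then have "u = - w * (coeff q 2 * coeff q 1)" "v = w' * (coeff q 2 * coeff q 0)"
    using t(2) n(2) by (metis mult_cancel_left less_irrefl)+
  then show "t \<in> \<int>" "n \<in> \<int>" using t n by simp_all
qed

text \<open>The square of the reduced denominator of \<open>b\<close> must divide
  \<open>D\<close>.\<close>

lemma int_if_squarefree_mult_square_int: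
  fixes b :: real
  assumes "squarefree D" "b \<in> \<rat>" "of_int D * b\<^sup>2 \<in> \<int>"
  shows "b \<in> \<int>"
proof -
  obtain p q where b: "b = of_int p / of_int q" "coprime p q" "q > 0"
    using assms(2) by (elim Rats_cases')
  obtain k where "of_int D * b\<^sup>2 = of_int k"
    using assms(3) by (auto elim: Ints_cases)
  then have "of_int (D * p\<^sup>2) = (of_int (k * q\<^sup>2) :: real)"
    using b by (simp add: field_simps)
  then have "D * p\<^sup>2 = k * q\<^sup>2" by (simp only: of_int_eq_iff)
  then have "q\<^sup>2 dvd D * p\<^sup>2" by simp
  moreover have "coprime (q\<^sup>2) (p\<^sup>2)" using b by (simp add: coprime_commute)
  ultimately have "q\<^sup>2 dvd D" by (simp add: coprime_dvd_mult_left_iff)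
  then have "q dvd 1" using squarefreeD assms(1) by blast
  then show ?thesis using b by simp
qed

text \<open>For x = a + b sqrt D, the trace 2a and the norm a^2 - D b^2 are integers. Then D (2b)^2
  is the square of the trace minus four times the norm, so 2b is an integer because \<open>D\<close>
  is squarefree. The divisibility by 4 is the integrality of the norm.\<close>

lemma quad_int_half_ints:
  assumes "D \<ge> 2" "squarefree D" "x \<in> quad_int D"
  obtains m n :: int where "x = (of_int m + of_int n * sqrt (of_int D)) / 2" "4 dvd m\<^sup>2 - D * n\<^sup>2"
proof -
  let ?s = "sqrt (of_int D)"
  obtain a b where ab: "a \<in> \<rat>" "b \<in> \<rat>" "x = a + b * ?s" "algebraic_int x"
    using assms(3) by (auto simp: quad_int_def quad_field_def)
  have "2 * a \<in> \<int> \<and> a\<^sup>2 - of_int D * b\<^sup>2 \<in> \<int>"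
  proof (cases "b = 0")
    case True
    then have "a \<in> \<int>" using ab rational_algebraic_int_is_int by simp
    then show ?thesis using True by simp
  next
    case False
    have "x \<notin> \<rat>"
    proof
      assume "x \<in> \<rat>"
      then have "a - x \<in> \<rat>" using ab(1) by (rule Rats_diff[rotated])
      then have "b = 0"
        using sqrt_rat_independent(2)[OF assms(1,2) _ ab(2), of "a - x"] ab(3) by simp
      then show False using False by simp
    qed
    moreover have "x\<^sup>2 - (2 * a) * x + (a\<^sup>2 - of_int D * b\<^sup>2) = 0"
      using ab assms by (simp add: algebra_simps power2_eq_square)
    ultimately show ?thesis
      using algebraic_int_quadratic[OF ab(4), of "2 * a" "a\<^sup>2 - of_int D * b\<^sup>2"] ab by auto
  qed
  then obtain m k where mk: "2 * a = of_int m" "a\<^sup>2 - of_int D * b\<^sup>2 = of_int k"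
    by (auto elim!: Ints_cases)
  have "of_int D * (2 * b)\<^sup>2 = (2 * a)\<^sup>2 - 4 * (a\<^sup>2 - of_int D * b\<^sup>2)"
    by (simp add: power2_eq_square)
  also have "\<dots> = of_int (m\<^sup>2 - 4 * k)" by (simp add: mk)
  finally have *: "of_int D * (2 * b)\<^sup>2 = of_int (m\<^sup>2 - 4 * k)" .
  then have "2 * b \<in> \<int>"
    using int_if_squarefree_mult_square_int[OF assms(2), of "2 * b"] ab by auto
  then obtain n where n: "2 * b = of_int n" by (auto elim: Ints_cases)
  have "of_int (D * n\<^sup>2) = (of_int (m\<^sup>2 - 4 * k) :: real)"
    using * by (simp add: n)
  then have "m\<^sup>2 - D * n\<^sup>2 = 4 * k" by (simp only: of_int_eq_iff)
  moreover have "x = (of_int m + of_int n * ?s) / 2"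
    unfolding ab(3) mk(1)[symmetric] n[symmetric] by (simp add: field_simps)
  ultimately show ?thesis using that by simp
qed

lemma square_mod_4: "(x::int)\<^sup>2 mod 4 = (if even x then 0 else 1)"
proof (cases "even x")
  case True
  then show ?thesis by (auto elim!: evenE simp: power2_eq_square)
next
  case False
  then obtain k where "x = 2 * k + 1" by (auto elim: oddE)
  then have "x\<^sup>2 = 4 * (k\<^sup>2 + k) + 1" by (simp add: power2_eq_square algebra_simps)
  then have "x\<^sup>2 mod 4 = 1" by presburger
  then show ?thesis using False by simp
qed

lemma half_ints_parity:
  fixes D m n :: int
  assumes "4 dvd m\<^sup>2 - D * n\<^sup>2"
  shows "D mod 4 = 2 \<or> D mod 4 = 3 \<Longrightarrow> even m \<and> even n"
    and "D mod 4 = 1 \<Longrightarrow> even m \<longleftrightarrow> even n"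
proof -
  have "m\<^sup>2 mod 4 = (D * n\<^sup>2) mod 4"
    using assms by (simp add: mod_eq_dvd_iff)
  also have "\<dots> = ((D mod 4) * (n\<^sup>2 mod 4)) mod 4"
    by (simp add: mod_mult_eq)
  finally show "D mod 4 = 2 \<or> D mod 4 = 3 \<Longrightarrow> even m \<and> even n"
    and "D mod 4 = 1 \<Longrightarrow> even m \<longleftrightarrow> even n"
    by (auto simp: square_mod_4 split: if_splits)
qed

lemma quad_int_2_3:
  assumes "D \<ge> 2" "squarefree D" "D mod 4 = 2 \<or> D mod 4 = 3" "x \<in> quad_int D"
  shows "\<exists>m n :: int. x = of_int m + of_int n * sqrt (of_int D)"
proof -
  obtain m n :: int where x: "x = (of_int m + of_int n * sqrt (of_int D)) / 2" "4 dvd m\<^sup>2 - D * n\<^sup>2"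
    using quad_int_half_ints assms by blast
  then obtain k l where "m = 2 * k" "n = 2 * l"
    using half_ints_parity(1) assms(3) by (meson evenE)
  then show ?thesis using x(1) by (intro exI[of _ k] exI[of _ l]) simp
qed

lemma quad_int_1:
  assumes "D \<ge> 2" "squarefree D" "D mod 4 = 1" "x \<in> quad_int D"
  shows "\<exists>m n :: int. x = (of_int m + of_int n * sqrt (of_int D)) / 2 \<and> (even m \<longleftrightarrow> even n)"
  using quad_int_half_ints assms half_ints_parity(2) by metis

subsection \<open>Gram determinants modulo D\<close>

lemma det_4:
  fixes f :: "4 \<Rightarrow> 4 \<Rightarrow> 'a::comm_ring_1"
  shows "det (\<chi> i j. f i j) =
     f 1 1 * f 2 2 * f 3 3 * f 4 4 - f 1 1 * f 2 2 * f 3 4 * f 4 3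
     - f 1 1 * f 2 3 * f 3 2 * f 4 4 + f 1 1 * f 2 3 * f 3 4 * f 4 2
     + f 1 1 * f 2 4 * f 3 2 * f 4 3 - f 1 1 * f 2 4 * f 3 3 * f 4 2
     - f 1 2 * f 2 1 * f 3 3 * f 4 4 + f 1 2 * f 2 1 * f 3 4 * f 4 3
     + f 1 2 * f 2 3 * f 3 1 * f 4 4 - f 1 2 * f 2 3 * f 3 4 * f 4 1
     - f 1 2 * f 2 4 * f 3 1 * f 4 3 + f 1 2 * f 2 4 * f 3 3 * f 4 1
     + f 1 3 * f 2 1 * f 3 2 * f 4 4 - f 1 3 * f 2 1 * f 3 4 * f 4 2
     - f 1 3 * f 2 2 * f 3 1 * f 4 4 + f 1 3 * f 2 2 * f 3 4 * f 4 1
     + f 1 3 * f 2 4 * f 3 1 * f 4 2 - f 1 3 * f 2 4 * f 3 2 * f 4 1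
     - f 1 4 * f 2 1 * f 3 2 * f 4 3 + f 1 4 * f 2 1 * f 3 3 * f 4 2
     + f 1 4 * f 2 2 * f 3 1 * f 4 3 - f 1 4 * f 2 2 * f 3 3 * f 4 1
     - f 1 4 * f 2 3 * f 3 1 * f 4 2 + f 1 4 * f 2 3 * f 3 2 * f 4 1"
proof -
  have f1: "finite {2::4, 3, 4}" "1 \<notin> {2::4, 3, 4}" by auto
  have f2: "finite {3::4, 4}" "2 \<notin> {3::4, 4}" by auto
  have f3: "finite {4::4}" "3 \<notin> {4::4}" by auto
  show ?thesis
    unfolding det_def UNIV_4
    unfolding sum_over_permutations_insert[OF f1]
    unfolding sum_over_permutations_insert[OF f2]
    unfolding sum_over_permutations_insert[OF f3]
    unfolding permutes_sing
    by (simp add: sign_swap_id permutation_swap_id sign_compose sign_id swap_id_eq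
        permutation_compose algebra_simps)
qed

lemma cong_det:
  fixes f g :: "'n::finite \<Rightarrow> 'n \<Rightarrow> int"
  assumes "\<And>i j. [f i j = g i j] (mod D)"
  shows "[det (\<chi> i j. f i j) = det (\<chi> i j. g i j)] (mod D)"
  unfolding det_def by (auto intro!: cong_sum cong_mult cong_prod assms)

text \<open>The factors are padded to square matrices, the left one by a zero column, so the product
  has determinant 0.\<close>

lemma dvd_det_if_rank_le_3:
  fixes f :: "4 \<Rightarrow> 4 \<Rightarrow> int" and X :: "4 \<Rightarrow> nat \<Rightarrow> int" and W :: "nat \<Rightarrow> 4 \<Rightarrow> int"
  assumes "\<And>i j. [f i j = (\<Sum>k=1..3. X i k * W k j)] (mod D)"
  shows "D dvd det (\<chi> i j. f i j)"
proof -
  \<comment> \<open>\<open>idx\<close> sends index 4 to 3 by default; the resulting row of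
    \<open>W'\<close> only meets the zero column of \<open>X'\<close>.\<close>
  define idx :: "4 \<Rightarrow> nat" where "idx k = (if k = 1 then 1 else if k = 2 then 2 else 3)" for k
  define X' :: "int^4^4" where "X' = (\<chi> i k. if k = 4 then 0 else X i (idx k))"
  define W' :: "int^4^4" where "W' = (\<chi> k j. W (idx k) j)"
  have "(\<chi> i j. \<Sum>k=1..3. X i k * W k j) = X' ** W'"
    by (simp add: matrix_matrix_mult_def X'_def W'_def sum_4 idx_def eval_nat_numeral)
  moreover have "det X' = 0"
    by (rule det_zero_column(1)[of 4]) (simp add: X'_def column_def vec_eq_iff)
  ultimately show ?thesis
    using cong_det[of f "\<lambda>i j. \<Sum>k=1..3. X i k * W k j", OF assms]
    by (simp add: det_mul cong_0_iff)
qed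

text \<open>The expression is the Gram determinant of \<open>u\<close>, \<open>v\<close>,
  \<open>w\<close>, \<open>x\<close>. The two vanishing entries match the escalation, where the
  vector of norm 1 is kept orthogonal to the next two.\<close>

lemma dvd_gram_det:
  fixes g :: "'v \<Rightarrow> 'v \<Rightarrow> int" and X :: "'v \<Rightarrow> nat \<Rightarrow> int" and W :: "nat \<Rightarrow> 'v \<Rightarrow> int"
  assumes sym: "\<And>u v. g u v = g v u"
    and cong: "\<And>u v. [g u v = (\<Sum>k=1..3. X u k * W k v)] (mod D)"
    and "g u v = 0" "g u w = 0"
  shows "D dvd g u u * (g v v * g w w * g x x + 2 * g v w * g v x * g w x - g v v * (g w x)\<^sup>2
              - g w w * (g v x)\<^sup>2 - g x x * (g v w)\<^sup>2)
            - (g u x)\<^sup>2 * (g v v * g w w - (g v w)\<^sup>2)"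
proof -
  define e :: "4 \<Rightarrow> 'v" where
    "e i = (if i = 1 then u else if i = 2 then v else if i = 3 then w else x)" for i
  have e: "e 1 = u" "e 2 = v" "e 3 = w" "e 4 = x" by (simp_all add: e_def)
  have "D dvd det (\<chi> i j. g (e i) (e j))"
    by (rule dvd_det_if_rank_le_3[of _ "\<lambda>i. X (e i)" "\<lambda>k j. W k (e j)"]) (rule cong)
  moreover have "g v u = 0" "g w u = 0" "g w v = g v w" "g x u = g u x" "g x v = g v x" "g x w = g w x"
    using assms(3,4) sym by metis+
  ultimately show ?thesis
    by (simp add: det_4 e assms(3,4) power2_eq_square algebra_simps)
qed

subsection \<open>Escalation\<close>

text \<open>A table of squares turns each search into a finite evaluation. The largest bound on a
  square that occurs is 126, in the nonorthogonal case.\<close>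

abbreviation squares_lt_144 :: "int set" where
  "squares_lt_144 \<equiv> {0, 1, 4, 9, 16, 25, 36, 49, 64, 81, 100, 121}"

lemma square_mem_squares_lt_144:
  fixes x :: int
  assumes "x\<^sup>2 < 144"
  shows "x\<^sup>2 \<in> squares_lt_144"
proof -
  have "\<bar>x\<bar>\<^sup>2 < 12\<^sup>2" using assms by simp
  then have "\<bar>x\<bar> < 12" by (rule power_less_imp_less_base) auto
  then have "\<bar>x\<bar> \<in> {0..<12}" by simp
  also have "{0..<12} = {0, 1, 2, 3, 4, 5, 6, 7, 8, 9, 10, 11::int}" by code_simp
  finally have "\<bar>x\<bar> \<in> \<dots>" .
  then have "\<bar>x\<bar>\<^sup>2 \<in> squares_lt_144"
    by (elim insertE emptyE; simp only:) simp_all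
  then show ?thesis by simp
qed

text \<open>\<open>lin k u l v\<close> stands for k u + l v, so no module structure on the vectors
  has to be set up; they are later pairs of integer coordinate functions.\<close>

locale escalation =
  fixes D :: int
    and B :: "'v \<Rightarrow> 'v \<Rightarrow> int"
    and lin :: "int \<Rightarrow> 'v \<Rightarrow> int \<Rightarrow> 'v \<Rightarrow> 'v"
  assumes B_sym: "B u v = B v u"
    and B_lin: "B (lin k u l v) w = k * B u w + l * B v w"
    and B_nonneg: "B u u \<ge> 0"
    and B_universal: "m > 0 \<Longrightarrow> \<exists>u. B u u = m"
    and D_dvd_gram: "B u v = 0 \<Longrightarrow> B u w = 0 \<Longrightarrow>
      D dvd B u u * (B v v * B w w * B x x + 2 * B v w * B v x * B w x - B v v * (B w x)\<^sup>2
              - B w w * (B v x)\<^sup>2 - B x x * (B v w)\<^sup>2)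
            - (B u x)\<^sup>2 * (B v v * B w w - (B v w)\<^sup>2)"
begin

lemma B_lin_right: "B w (lin k u l v) = k * B w u + l * B w v"
  using B_lin[of k u l v w] by (simp add: B_sym)

text \<open>\<open>m\<close> is the Gram determinant of the three given vectors and a vector
  \<open>w\<close> of norm \<open>t\<close>, written in the inner products \<open>x\<close>,
  \<open>y\<close>, \<open>z\<close> of \<open>w\<close> with them.\<close>

lemma escalate:
  fixes p q r t :: int
  assumes gram: "B v1 v1 = 1" "B v1 v2 = 0" "B v1 v3 = 0"
      "B v2 v2 = p" "B v3 v3 = q" "B v2 v3 = r"
    and "p * q - r\<^sup>2 > 0" "t > 0"
  obtains x y z m where
    "m = (p * q - r\<^sup>2) * (t - x\<^sup>2) - q * y\<^sup>2 + 2 * r * y * z - p * z\<^sup>2"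
    "m \<ge> 0" "D dvd m"
proof -
  obtain w where w: "B w w = t"
    using B_universal[OF \<open>t > 0\<close>] by blast
  define x where "x = B v1 w"
  define y where "y = B v2 w"
  define z where "z = B v3 w"
  define \<delta> where "\<delta> = p * q - r\<^sup>2"
  define m where "m = (p * q - r\<^sup>2) * (t - x\<^sup>2) - q * y\<^sup>2 + 2 * r * y * z - p * z\<^sup>2"
  have sym: "B v2 v1 = 0" "B v3 v1 = 0" "B v3 v2 = r" "B w v1 = x" "B w v2 = y" "B w v3 = z"
    using gram by (simp_all add: B_sym x_def y_def z_def)
  \<comment> \<open>This is \<delta> times the component of \<open>w\<close> orthogonal to
    \<open>v1\<close>, \<open>v2\<close>, \<open>v3\<close>; the coefficients of \<open>v2\<close>
    and \<open>v3\<close> come from the adjugate of their Gram matrix.\<close>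
  define u where
    "u = lin 1 (lin \<delta> w (- \<delta> * x) v1) 1 (lin (r * z - q * y) v2 (r * y - p * z) v3)"
  have "B u u = \<delta> * m"
    unfolding u_def B_lin B_lin_right
    by (simp add: gram sym w x_def[symmetric] y_def[symmetric] z_def[symmetric] m_def \<delta>_def
        power2_eq_square algebra_simps)
  then have "m \<ge> 0"
    using B_nonneg[of u] assms(7) by (simp add: \<delta>_def zero_le_mult_iff)
  moreover have "D dvd m"
    using D_dvd_gram[OF gram(2,3), of w]
    by (simp add: gram w x_def[symmetric] y_def[symmetric] z_def[symmetric] m_def
        power2_eq_square algebra_simps)
  ultimately show ?thesis
    using that m_def by blast
qed

text \<open>For a diagonal Gram matrix \<open>m \<ge> 0\<close> bounds each square separately, which
  makes the search finite.\<close>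

lemma orthogonal_escalate:
  fixes p q t :: int
  assumes "B v1 v1 = 1" "B v1 v2 = 0" "B v1 v3 = 0" "B v2 v2 = p" "B v3 v3 = q" "B v2 v3 = 0"
    and "p > 0" "q > 0" "t > 0"
  obtains x y z m where "m = p * q * t - p * q * x\<^sup>2 - q * y\<^sup>2 - p * z\<^sup>2" "m \<ge> 0" "D dvd m"
    "x\<^sup>2 \<le> t" "y\<^sup>2 \<le> p * t" "z\<^sup>2 \<le> q * t"
proof -
  have "p * q - 0\<^sup>2 > 0" using assms by simp
  from escalate[OF assms(1-6) this assms(9)]
  obtain x y z m where m: "m = (p * q - 0\<^sup>2) * (t - x\<^sup>2) - q * y\<^sup>2 + 2 * 0 * y * z - p * z\<^sup>2"
    "m \<ge> 0" "D dvd m" by metis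
  have 1: "m = p * q * t - p * q * x\<^sup>2 - q * y\<^sup>2 - p * z\<^sup>2"
    using m by (simp add: algebra_simps)
  have nn: "0 \<le> p * q * x\<^sup>2" "0 \<le> q * y\<^sup>2" "0 \<le> p * z\<^sup>2"
    using assms by auto
  have "(p * q) * x\<^sup>2 \<le> (p * q) * t" "q * y\<^sup>2 \<le> q * (p * t)" "p * z\<^sup>2 \<le> p * (q * t)"
    using nn m(2) 1 by (auto simp: algebra_simps)
  then have "x\<^sup>2 \<le> t" "y\<^sup>2 \<le> p * t" "z\<^sup>2 \<le> q * t"
    using assms by (simp_all only: mult_le_cancel_left_pos mult_pos_pos)
  then show ?thesis
    using that 1 m by blast
qed

section \<open>The nine ternary forms and the determinants they allow\<close>

context
  assumes D: "D > 62" "squarefree D"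
begin

text \<open>The squares of 2, 3 and 7 are enough to discard every non-squarefree determinant above
  62 that the searches meet.\<close>

lemma not_dvd_squares: "D mod 4 \<noteq> 0" "D mod 9 \<noteq> 0" "D mod 49 \<noteq> 0"
  using squarefreeD[OF D(2), of 2] squarefreeD[OF D(2), of 3] squarefreeD[OF D(2), of 7]
  by (auto simp: mod_eq_0_iff_dvd)

text \<open>The bound 126 is twice 63, the least value allowed for \<open>D\<close>, so
  \<open>D\<close> is its only positive multiple below it.\<close>

lemma eq_if_dvd:
  assumes "D dvd m" "m > 0" "m < 126"
  shows "m = D"
proof -
  obtain k where k: "m = D * k" using assms by auto
  then have "k > 0" using assms D by (simp add: zero_less_mult_iff)
  moreover have "k < 2"
  proof (rule ccontr)
    assume "\<not> k < 2"
    then have "D * 2 \<le> D * k" using D by (intro mult_left_mono) auto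
    with k assms D show False by simp
  qed
  ultimately show ?thesis using k by simp
qed

lemma zero_if_dvd:
  assumes "D dvd m" "m \<ge> 0" "m < 63"
  shows "m = 0"
  using assms D zdvd_imp_le[of D m] by force

lemma orthogonal_ternary_small:
  assumes "B v1 v1 = 1" "B v1 v2 = 0" "B v1 v3 = 0" "B v2 v2 = p" "B v3 v3 = q" "B v2 v3 = 0"
    and pq: "(p, q) \<in> {(1, 1), (1, 2), (1, 3), (2, 2), (2, 3)}"
  shows False
proof -
  \<comment> \<open>The truants of the five diagonal forms.\<close>
  obtain t :: int where pqt: "(p, q, t) \<in> {(1, 1, 7), (1, 2, 14), (1, 3, 6), (2, 2, 7), (2, 3, 10)}"
    using pq by auto
  \<comment> \<open>A solution would represent \<open>t\<close> by the diagonal form at the rational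
    point (x, y/p, z/q). Its absence gives \<open>m \<noteq> 0\<close>, while p q t is at most 60,
    hence below \<open>D\<close>.\<close>
  have "\<forall>(p, q, t) \<in> {(1, 1, 7), (1, 2, 14), (1, 3, 6), (2, 2, 7), (2, 3, 10)}.
      \<forall>x \<in> squares_lt_144. \<forall>y \<in> squares_lt_144. \<forall>z \<in> squares_lt_144. p * q * x + q * y + p * z \<noteq> p * q * (t::int)"
    by code_simp
  from bspec[OF this pqt] have no_rep:
      "\<forall>x \<in> squares_lt_144. \<forall>y \<in> squares_lt_144. \<forall>z \<in> squares_lt_144. p * q * x + q * y + p * z \<noteq> p * q * t"
    by (simp only: prod.case)
  have "p > 0" "q > 0" "t > 0" using pqt by auto
  from orthogonal_escalate[OF assms(1-6) this]
  obtain x y z m where m: "m = p * q * t - p * q * x\<^sup>2 - q * y\<^sup>2 - p * z\<^sup>2" "m \<ge> 0" "D dvd m"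
    "x\<^sup>2 \<le> t" "y\<^sup>2 \<le> p * t" "z\<^sup>2 \<le> q * t" by metis
  have "0 \<le> p * q * x\<^sup>2" "0 \<le> q * y\<^sup>2" "0 \<le> p * z\<^sup>2"
    using \<open>p > 0\<close> \<open>q > 0\<close> by auto
  then have "m \<le> p * q * t" using m by simp
  moreover have "p * q * t < 63" using pqt by auto
  ultimately have "m = 0" using zero_if_dvd[OF m(3,2)] by linarith
  moreover have "t < 144" "p * t < 144" "q * t < 144"
    using pqt by auto
  then have "x\<^sup>2 \<in> squares_lt_144" "y\<^sup>2 \<in> squares_lt_144" "z\<^sup>2 \<in> squares_lt_144"
    by - (rule square_mem_squares_lt_144, use m(4-6) in linarith)+
  ultimately show False
    using m(1) no_rep[rule_format, of "x\<^sup>2" "y\<^sup>2" "z\<^sup>2"] by linarith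
qed

text \<open>The truant 14 bounds the determinant by 8 * 14 = 112. All candidates are even, and those
  divisible by 4, 9 or 49 drop out.\<close>

lemma ternary_124:
  assumes "B v1 v1 = 1" "B v1 v2 = 0" "B v1 v3 = 0" "B v2 v2 = 2" "B v3 v3 = 4" "B v2 v3 = 0"
  shows "D \<in> {66, 70, 74, 78, 82, 86, 94, 102, 106, 110}"
proof -
  have "(2::int) > 0" "(4::int) > 0" "(14::int) > 0" by auto
  from orthogonal_escalate[OF assms this]
  obtain x y z m where "m = 2 * 4 * 14 - 2 * 4 * x\<^sup>2 - 4 * y\<^sup>2 - 2 * z\<^sup>2" "m \<ge> 0" "D dvd m"
    "x\<^sup>2 \<le> 14" "y\<^sup>2 \<le> 2 * 14" "z\<^sup>2 \<le> 4 * 14" by metis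
  then have m: "m = 112 - 8 * x\<^sup>2 - 4 * y\<^sup>2 - 2 * z\<^sup>2" "m \<ge> 0" "D dvd m"
    "x\<^sup>2 \<le> 14" "y\<^sup>2 \<le> 28" "z\<^sup>2 \<le> 56" by simp_all
  have sq: "x\<^sup>2 \<in> squares_lt_144" "y\<^sup>2 \<in> squares_lt_144" "z\<^sup>2 \<in> squares_lt_144"
    by (rule square_mem_squares_lt_144, use m(4-6) in linarith)+
  have "\<forall>x \<in> squares_lt_144. \<forall>y \<in> squares_lt_144. \<forall>z \<in> squares_lt_144. let m = 112 - 8 * x - 4 * y - 2 * z in
      m \<noteq> 0 \<and> (m \<le> 62 \<or> m mod 4 = 0 \<or> m mod 9 = 0 \<or> m mod 49 = 0 \<or>
        m \<in> {66, 70, 74, 78, 82, 86, 94, 102, 106, 110})"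
    by code_simp
  from this[rule_format, OF sq] have check: "m \<noteq> 0" "m \<le> 62 \<or> m mod 4 = 0 \<or> m mod 9 = 0 \<or>
      m mod 49 = 0 \<or> m \<in> {66, 70, 74, 78, 82, 86, 94, 102, 106, 110}"
    unfolding Let_def m(1)[symmetric] by blast+
  have "m < 126"
    using m(1) zero_le_power2[of x] zero_le_power2[of y] zero_le_power2[of z] by linarith
  then have "m = D"
    using eq_if_dvd[OF m(3)] m(2) check(1) by linarith
  then show ?thesis
    using check(2) D(1) not_dvd_squares by auto
qed

text \<open>The truant 10 bounds the determinant by 100, but this alone leaves 67 and 83 as well; a
  further vector, of norm 15, removes them.\<close>

lemma ternary_125:
  assumes "B v1 v1 = 1" "B v1 v2 = 0" "B v1 v3 = 0" "B v2 v2 = 2" "B v3 v3 = 5" "B v2 v3 = 0"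
  shows "D \<in> {70, 77, 78, 82, 85, 87, 93, 95}"
proof -
  have "D \<in> {67, 83} \<union> {70, 77, 78, 82, 85, 87, 93, 95}"
  proof -
    have "(2::int) > 0" "(5::int) > 0" "(10::int) > 0" by auto
    from orthogonal_escalate[OF assms this]
    obtain x y z m where "m = 2 * 5 * 10 - 2 * 5 * x\<^sup>2 - 5 * y\<^sup>2 - 2 * z\<^sup>2" "m \<ge> 0" "D dvd m"
      "x\<^sup>2 \<le> 10" "y\<^sup>2 \<le> 2 * 10" "z\<^sup>2 \<le> 5 * 10" by metis
    then have m: "m = 100 - 10 * x\<^sup>2 - 5 * y\<^sup>2 - 2 * z\<^sup>2" "m \<ge> 0" "D dvd m"
      "x\<^sup>2 \<le> 10" "y\<^sup>2 \<le> 20" "z\<^sup>2 \<le> 50" by simp_all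
    have sq: "x\<^sup>2 \<in> squares_lt_144" "y\<^sup>2 \<in> squares_lt_144" "z\<^sup>2 \<in> squares_lt_144"
      by (rule square_mem_squares_lt_144, use m(4-6) in linarith)+
    have "\<forall>x \<in> squares_lt_144. \<forall>y \<in> squares_lt_144. \<forall>z \<in> squares_lt_144. let m = 100 - 10 * x - 5 * y - 2 * z in
        m \<noteq> 0 \<and> (m \<le> 62 \<or> m mod 4 = 0 \<or> m mod 9 = 0 \<or> m mod 49 = 0 \<or>
          m \<in> {67, 83} \<union> {70, 77, 78, 82, 85, 87, 93, 95})"
      by code_simp
    from this[rule_format, OF sq] have check: "m \<noteq> 0" "m \<le> 62 \<or> m mod 4 = 0 \<or> m mod 9 = 0 \<or>
        m mod 49 = 0 \<or> m \<in> {67, 83} \<union> {70, 77, 78, 82, 85, 87, 93, 95}"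
      unfolding Let_def m(1)[symmetric] by blast+
    have "m < 126"
      using m(1) zero_le_power2[of x] zero_le_power2[of y] zero_le_power2[of z] by linarith
    then have "m = D"
      using eq_if_dvd[OF m(3)] m(2) check(1) by linarith
    then show ?thesis
      using check(2) D(1) not_dvd_squares by auto
  qed
  \<comment> \<open>The determinants 67 and 83 belong to quaternary forms that miss 15.\<close>
  moreover have "D \<notin> {67, 83}"
  proof
    assume D': "D \<in> {67, 83}"
    have "(2::int) > 0" "(5::int) > 0" "(15::int) > 0" by auto
    from orthogonal_escalate[OF assms this]
    obtain x y z m where "m = 2 * 5 * 15 - 2 * 5 * x\<^sup>2 - 5 * y\<^sup>2 - 2 * z\<^sup>2" "m \<ge> 0" "D dvd m"
      "x\<^sup>2 \<le> 15" "y\<^sup>2 \<le> 2 * 15" "z\<^sup>2 \<le> 5 * 15" by metis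
    then have m: "m = 150 - 10 * x\<^sup>2 - 5 * y\<^sup>2 - 2 * z\<^sup>2" "m \<ge> 0" "D dvd m"
      "x\<^sup>2 \<le> 15" "y\<^sup>2 \<le> 30" "z\<^sup>2 \<le> 75" by simp_all
    have sq: "x\<^sup>2 \<in> squares_lt_144" "y\<^sup>2 \<in> squares_lt_144" "z\<^sup>2 \<in> squares_lt_144"
      by (rule square_mem_squares_lt_144, use m(4-6) in linarith)+
    \<comment> \<open>Since \<open>m\<close> may be as large as 150, equality with \<open>D\<close>
      no longer follows from divisibility. Residues are tested instead, which also excludes
      \<open>m = 0\<close>.\<close>
    have "\<forall>x \<in> squares_lt_144. \<forall>y \<in> squares_lt_144. \<forall>z \<in> squares_lt_144. let m = 150 - 10 * x - 5 * y - 2 * z in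
        m < 0 \<or> m mod 67 \<noteq> 0 \<and> m mod 83 \<noteq> 0"
      by code_simp
    from this[rule_format, OF sq] have "m mod 67 \<noteq> 0" "m mod 83 \<noteq> 0"
      unfolding Let_def m(1)[symmetric] using m(2) by linarith+
    with m(3) D' show False by (auto simp: mod_eq_0_iff_dvd)
  qed
  ultimately show ?thesis by blast
qed

text \<open>The truant 7 gives determinants at most 7 d with d = 2q - 1 equal to 7 or 9. Only 63
  could reach \<open>D\<close>, and it is not squarefree.\<close>

lemma ternary_nonorthogonal:
  assumes "B v1 v1 = 1" "B v1 v2 = 0" "B v1 v3 = 0" "B v2 v2 = 2" "B v3 v3 = q" "B v2 v3 = 1"
    and q: "q \<in> {4, 5}"
  shows False
proof -
  have "2 * q - 1\<^sup>2 > 0" "(7::int) > 0" using q by auto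
  from escalate[OF assms(1-6) this]
  obtain x y z m where m: "m = (2 * q - 1\<^sup>2) * (7 - x\<^sup>2) - q * y\<^sup>2 + 2 * 1 * y * z - 2 * z\<^sup>2"
     "m \<ge> 0" "D dvd m" by metis
  \<comment> \<open>Doubling \<open>m\<close> and completing the square in \<open>z\<close> removes
    the mixed term \<open>y * z\<close>.\<close>
  define d where "d = 2 * q - 1"
  define w where "w = 2 * z - y"
  have eq: "2 * m = 2 * d * (7 - x\<^sup>2) - d * y\<^sup>2 - w\<^sup>2"
    using m(1) by (simp add: d_def w_def power2_eq_square algebra_simps)
  have d: "d \<in> {7, 9}" using q by (auto simp: d_def)
  then have "d > 0" "d \<le> 9" by auto
  have nn: "0 \<le> d * x\<^sup>2" "0 \<le> d * y\<^sup>2" "0 \<le> w\<^sup>2" using \<open>d > 0\<close> by auto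
  have "m \<noteq> 63"
    using eq_if_dvd[of 63] m(3) not_dvd_squares by auto
  moreover have "2 * m = 14 * d - 2 * (d * x\<^sup>2) - d * y\<^sup>2 - w\<^sup>2"
    using eq by (simp add: algebra_simps)
  then have "m \<le> 63" using \<open>d \<le> 9\<close> nn by linarith
  ultimately have "m = 0" using zero_if_dvd[OF m(3,2)] by linarith
  then have eq0: "2 * d * x\<^sup>2 + d * y\<^sup>2 + w\<^sup>2 = 14 * d" using eq by (simp add: algebra_simps)
  then have "d * x\<^sup>2 \<le> d * 7" "d * y\<^sup>2 \<le> d * 14" "w\<^sup>2 \<le> 126"
    using nn \<open>d \<le> 9\<close> unfolding mult.assoc by linarith+
  then have "x\<^sup>2 \<le> 7" "y\<^sup>2 \<le> 14" "w\<^sup>2 \<le> 126"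
    using \<open>d > 0\<close> by (simp_all only: mult_le_cancel_left_pos)
  then have sq: "x\<^sup>2 \<in> squares_lt_144" "y\<^sup>2 \<in> squares_lt_144" "w\<^sup>2 \<in> squares_lt_144"
    by - (rule square_mem_squares_lt_144, linarith)+
  have "\<forall>d \<in> {7, 9}. \<forall>x \<in> squares_lt_144. \<forall>y \<in> squares_lt_144. \<forall>w \<in> squares_lt_144. 2 * d * x + d * y + w \<noteq> 14 * d"
    by code_simp
  from this[rule_format, OF d sq] eq0 show False by blast
qed

text \<open>The norms 1, 2 and then 3 or 5 are truants: x^2 misses 2, x^2 + y^2 misses 3, and x^2 +
  2 y^2 misses 5. Subtracting multiples of earlier vectors leads to the nine ternary forms.\<close>

lemma D_in_list: "D \<in> {66, 70, 74, 77, 78, 82, 85, 86, 87, 93, 94, 95, 102, 106, 110}"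
proof -
  obtain v1 where v1: "B v1 v1 = 1" using B_universal[of 1] by auto
  obtain w where w: "B w w = 2" using B_universal[of 2] by auto
  define v2 where "v2 = lin 1 w (- B v1 w) v1"
  have v12: "B v1 v2 = 0"
    by (simp add: v2_def B_lin_right v1)
  have v22: "B v2 v2 = 2 - (B v1 w)\<^sup>2"
    by (simp add: v2_def B_lin_right B_lin v1 w B_sym[of w v1] power2_eq_square)
  then have "(B v1 w)\<^sup>2 \<le> 2" using B_nonneg[of v2] by simp
  then have "(B v1 w)\<^sup>2 = 0 \<or> (B v1 w)\<^sup>2 = 1" using square_mem_squares_lt_144[of "B v1 w"] by auto
  with v22 consider "B v2 v2 = 1" | "B v2 v2 = 2" by fastforce
  then show ?thesis
  proof cases
    case 1
    obtain w where w: "B w w = 3" using B_universal[of 3] by auto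
    define v3 where "v3 = lin 1 w 1 (lin (- B v1 w) v1 (- B v2 w) v2)"
    have v13: "B v1 v3 = 0" "B v2 v3 = 0"
      by (simp_all add: v3_def B_lin_right v1 1 v12 B_sym[of v2 v1])
    have v33: "B v3 v3 = 3 - (B v1 w)\<^sup>2 - (B v2 w)\<^sup>2"
      by (simp add: v3_def B_lin_right B_lin v1 1 v12 w B_sym[of w v1] B_sym[of w v2]
          B_sym[of v2 v1] power2_eq_square algebra_simps)
    then have le: "(B v1 w)\<^sup>2 \<le> 3" "(B v2 w)\<^sup>2 \<le> 3"
      using B_nonneg[of v3] zero_le_power2[of "B v1 w"] zero_le_power2[of "B v2 w"] by linarith+
    then have "(B v1 w)\<^sup>2 = 0 \<or> (B v1 w)\<^sup>2 = 1" "(B v2 w)\<^sup>2 = 0 \<or> (B v2 w)\<^sup>2 = 1"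
      using square_mem_squares_lt_144[of "B v1 w"] square_mem_squares_lt_144[of "B v2 w"] by auto
    then have "B v3 v3 \<in> {1, 2, 3}" using v33 by auto
    then show ?thesis
      using orthogonal_ternary_small[OF v1 v12 v13(1) 1 refl v13(2)] by auto
  next
    case 2
    obtain w where w: "B w w = 5" using B_universal[of 5] by auto
    define w' where "w' = lin 1 w (- B v1 w) v1"
    define n where "n = B w' w'"
    define b where "b = B v2 w'"
    have v1w': "B v1 w' = 0"
      by (simp add: w'_def B_lin_right v1)
    have n: "n = 5 - (B v1 w)\<^sup>2"
      by (simp add: n_def w'_def B_lin_right B_lin v1 w B_sym[of w v1] power2_eq_square)
    then have "(B v1 w)\<^sup>2 \<le> 5" using B_nonneg[of w'] by (simp add: n_def)
    then have "(B v1 w)\<^sup>2 \<in> {0, 1, 4}" using square_mem_squares_lt_144[of "B v1 w"] by auto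
    then have n': "n \<in> {5, 4, 1}" using n by auto
    \<comment> \<open>This is the Cauchy-Schwarz inequality for \<open>v2\<close> and
      \<open>w'\<close>.\<close>
    have "B (lin 2 w' (- b) v2) (lin 2 w' (- b) v2) = 2 * (2 * n - b\<^sup>2)"
      by (simp add: B_lin_right B_lin 2 n_def[symmetric] b_def[symmetric] B_sym[of w' v2]
          power2_eq_square)
    then have bn: "b\<^sup>2 \<le> 2 * n" using B_nonneg[of "lin 2 w' (- b) v2"] by simp
    then have "\<bar>b\<bar>\<^sup>2 < 4\<^sup>2" using n' by auto
    then have "\<bar>b\<bar> < 4" by (rule power_less_imp_less_base) auto
    then have b: "b \<in> {-3, -2, -1, 0, 1, 2, 3}" by auto
    \<comment> \<open>Since \<open>v2\<close> has norm 2, subtracting b div 2 copies of it reduces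
      the inner product to 0 or 1.\<close>
    define v3 where "v3 = lin 1 w' (- (b div 2)) v2"
    have v13: "B v1 v3 = 0"
      by (simp add: v3_def B_lin_right v1w' v12)
    have v23: "B v2 v3 = b mod 2"
      by (simp add: v3_def B_lin_right 2 b_def[symmetric] minus_div_mult_eq_mod[symmetric])
    have v33: "B v3 v3 = n - 2 * (b div 2) * b + 2 * (b div 2)\<^sup>2"
      by (simp add: v3_def B_lin_right B_lin 2 n_def[symmetric] b_def[symmetric] B_sym[of w' v2]
          power2_eq_square algebra_simps)
    have "b mod 2 = 0 \<and> B v3 v3 \<in> {1, 2, 3, 4, 5} \<or> b mod 2 = 1 \<and> B v3 v3 \<in> {1, 4, 5}"
      using b n' bn v33 by (elim insertE emptyE; simp)
    then consider (a) "B v2 v3 = 0" "B v3 v3 = 1" | (b) "B v2 v3 = 0" "B v3 v3 \<in> {2, 3}"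
      | (c) "B v2 v3 = 0" "B v3 v3 = 4" | (d) "B v2 v3 = 0" "B v3 v3 = 5"
      | (e) "B v2 v3 = 1" "B v3 v3 = 1" | (f) "B v2 v3 = 1" "B v3 v3 \<in> {4, 5}"
      using v23 by auto
    then show ?thesis
    proof cases
      case a
      \<comment> \<open>Exchanging \<open>v2\<close> and \<open>v3\<close> gives the diagonal form
        1, 1, 2.\<close>
      then have "B v3 v2 = 0" by (simp add: B_sym)
      then show ?thesis
        using orthogonal_ternary_small[OF v1 v13 v12 a(2) 2] by auto
    next
      case b
      then show ?thesis
        using orthogonal_ternary_small[OF v1 v12 v13 2 refl b(1)] by auto
    next
      case c
      then show ?thesis
        using ternary_124[OF v1 v12 v13 2 c(2) c(1)] by auto
    next
      case d
      then show ?thesis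
        using ternary_125[OF v1 v12 v13 2 d(2) d(1)] by auto
    next
      case e
      \<comment> \<open>The binary form with diagonal 2, 1 and inner product 1 is a sum of two
        squares in another basis.\<close>
      define v2' where "v2' = lin 1 v2 (-1) v3"
      have "B v1 v2' = 0" "B v2' v2' = 1" "B v2' v3 = 0"
        using e by (simp_all add: v2'_def B_lin B_lin_right v12 v13 2 B_sym[of v3 v2])
      then show ?thesis
        using orthogonal_ternary_small[OF v1 _ v13 _ e(2), of v2' 1] by auto
    next
      case f
      then show ?thesis
        using ternary_nonorthogonal[OF v1 v12 v13 2 refl f(1)] by auto
    qed
  qed
qed

end

end

subsection \<open>The integral form of a generalized quadratic form\<close>

lemma sum_1_3: "(\<Sum>i=1..3. f i) = f 1 + f 2 + f (3::nat)"
  by (simp add: numeral_3_eq_3 numeral_2_eq_2)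

lemma sum_2_3: "(\<Sum>i=2..3. f i) = f 2 + f (3::nat)"
  by (simp add: numeral_3_eq_3 numeral_2_eq_2)

lemma gqf_eval_cong:
  assumes "\<And>i. i \<in> {1..n} \<Longrightarrow> z i = z' i"
  shows "gqf_eval D n G z = gqf_eval D n G z'"
  using assms unfolding gqf_eval_def by (auto intro!: sum.cong arg_cong2[of _ _ _ _ "(+)"])

lemma gqf_eval_parts:
  assumes "D \<ge> 2" "squarefree D"
    and \<alpha>: "\<forall>i\<in>{1..n}. \<forall>j\<in>{i..n}. gqf_\<alpha> G i j = a i j + b i j * sqrt (of_int D)"
    and \<beta>: "\<forall>i\<in>{1..n}. \<forall>j\<in>{1..n}. gqf_\<beta> G i j = c i j + d i j * sqrt (of_int D)"
    and \<gamma>: "\<forall>i\<in>{1..n}. \<forall>j\<in>{i..n}. gqf_\<gamma> G i j = e i j + f i j * sqrt (of_int D)"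
    and xy: "\<And>i. x i \<in> \<rat>" "\<And>i. y i \<in> \<rat>"
  shows "gqf_eval D n G (\<lambda>i. x i + y i * sqrt (of_int D)) =
      (\<Sum>i=1..n. \<Sum>j=i..n. (a i j + e i j) * (x i * x j + of_int D * y i * y j)
          + of_int D * (b i j - f i j) * (x i * y j + y i * x j))
      + (\<Sum>i=1..n. \<Sum>j=1..n. c i j * (x i * x j - of_int D * y i * y j)
          + of_int D * d i j * (y i * x j - x i * y j))
      + ((\<Sum>i=1..n. \<Sum>j=i..n. (b i j + f i j) * (x i * x j + of_int D * y i * y j)
          + (a i j - e i j) * (x i * y j + y i * x j))
        + (\<Sum>i=1..n. \<Sum>j=1..n. d i j * (x i * x j - of_int D * y i * y j)
          + c i j * (y i * x j - x i * y j))) * sqrt (of_int D)"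
proof -
  let ?s = "sqrt (of_int D)"
  have s: "?s * ?s = of_int D" "\<And>t. ?s * (?s * t) = of_int D * t"
    using assms(1) by (simp_all flip: mult.assoc)
  have split: "(\<Sum>i\<in>I. \<Sum>j\<in>J i. U i j + V i j * ?s) = (\<Sum>i\<in>I. \<Sum>j\<in>J i. U i j) + (\<Sum>i\<in>I. \<Sum>j\<in>J i. V i j) * ?s"
    for U V :: "nat \<Rightarrow> nat \<Rightarrow> real" and I J
    by (simp add: sum.distrib sum_distrib_right)
  have collect: "p + q * ?s + (r + t * ?s) = p + r + (q + t) * ?s" for p q r t
    by (simp add: algebra_simps)
  have conj: "quad_conj D (x i + y i * ?s) = x i - y i * ?s" for i
    using quad_conj_eq assms(1,2) xy by blast
  have 1: "gqf_\<alpha> G i j * (x i + y i * ?s) * (x j + y j * ?s)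
        + gqf_\<gamma> G i j * (x i - y i * ?s) * (x j - y j * ?s) =
      (a i j + e i j) * (x i * x j + of_int D * y i * y j)
          + of_int D * (b i j - f i j) * (x i * y j + y i * x j)
      + ((b i j + f i j) * (x i * x j + of_int D * y i * y j)
          + (a i j - e i j) * (x i * y j + y i * x j)) * ?s"
    if "i \<in> {1..n}" "j \<in> {i..n}" for i j
    unfolding \<alpha>[rule_format, OF that] \<gamma>[rule_format, OF that] by (simp add: algebra_simps s)
  have 2: "gqf_\<beta> G i j * (x i + y i * ?s) * (x j - y j * ?s) =
      c i j * (x i * x j - of_int D * y i * y j) + of_int D * d i j * (y i * x j - x i * y j)
      + (d i j * (x i * x j - of_int D * y i * y j) + c i j * (y i * x j - x i * y j)) * ?s"
    if "i \<in> {1..n}" "j \<in> {1..n}" for i j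
    unfolding \<beta>[rule_format, OF that] by (simp add: algebra_simps s)
  have "gqf_eval D n G (\<lambda>i. x i + y i * ?s) =
      (\<Sum>i=1..n. \<Sum>j=i..n. gqf_\<alpha> G i j * (x i + y i * ?s) * (x j + y j * ?s)
        + gqf_\<gamma> G i j * (x i - y i * ?s) * (x j - y j * ?s))
      + (\<Sum>i=1..n. \<Sum>j=1..n. gqf_\<beta> G i j * (x i + y i * ?s) * (x j - y j * ?s))"
    unfolding gqf_eval_def conj by (simp add: sum.distrib)
  also have "\<dots> = (\<Sum>i=1..n. \<Sum>j=i..n. (a i j + e i j) * (x i * x j + of_int D * y i * y j)
          + of_int D * (b i j - f i j) * (x i * y j + y i * x j)
      + ((b i j + f i j) * (x i * x j + of_int D * y i * y j)
          + (a i j - e i j) * (x i * y j + y i * x j)) * ?s)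
      + (\<Sum>i=1..n. \<Sum>j=1..n. c i j * (x i * x j - of_int D * y i * y j)
          + of_int D * d i j * (y i * x j - x i * y j)
      + (d i j * (x i * x j - of_int D * y i * y j) + c i j * (y i * x j - x i * y j)) * ?s)"
    using 1 2 by (auto intro!: arg_cong2[of "sum _ _" "sum _ _" "sum _ _" "sum _ _" "(+)"] sum.cong)
  also have "\<dots> = (\<Sum>i=1..n. \<Sum>j=i..n. (a i j + e i j) * (x i * x j + of_int D * y i * y j)
          + of_int D * (b i j - f i j) * (x i * y j + y i * x j))
      + (\<Sum>i=1..n. \<Sum>j=1..n. c i j * (x i * x j - of_int D * y i * y j)
          + of_int D * d i j * (y i * x j - x i * y j))
      + ((\<Sum>i=1..n. \<Sum>j=i..n. (b i j + f i j) * (x i * x j + of_int D * y i * y j)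
          + (a i j - e i j) * (x i * y j + y i * x j))
        + (\<Sum>i=1..n. \<Sum>j=1..n. d i j * (x i * x j - of_int D * y i * y j)
          + c i j * (y i * x j - x i * y j))) * ?s"
    unfolding split by (rule collect)
  finally show ?thesis .
qed

text \<open>The Gram matrix of twice the form with upper triangular coefficients \<open>a\<close>.
  The doubling comes from adding conjugate terms, so the entries are integral whenever
  \<open>a\<close> is, without evenness of cross terms.\<close>

definition polar_coeff :: "(nat \<Rightarrow> nat \<Rightarrow> 'a::comm_ring_1) \<Rightarrow> nat \<Rightarrow> nat \<Rightarrow> 'a" where
  "polar_coeff a i j = (if i = j then 2 * a i i else if i < j then a i j else a j i)"

text \<open>
  The value of a form with rational values involves no \<open>\<surd>D\<close>, so the irrational part of
  the evaluation vanishes identically, and its coefficients are zero.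
\<close>

lemma ternary_normal_form:
  fixes a b c d e f :: "nat \<Rightarrow> nat \<Rightarrow> real"
  assumes D: "D \<ge> 2" "squarefree D" and Z: "gqf_Z_valued D 3 G"
    and coeffs: "\<forall>i\<in>{1..3}. \<forall>j\<in>{i..3}. gqf_\<alpha> G i j = a i j + b i j * sqrt (of_int D)"
      "\<forall>i\<in>{1..3}. \<forall>j\<in>{1..3}. gqf_\<beta> G i j = c i j + d i j * sqrt (of_int D)"
      "\<forall>i\<in>{1..3}. \<forall>j\<in>{i..3}. gqf_\<gamma> G i j = e i j + f i j * sqrt (of_int D)"
    and rat: "\<And>i j. a i j \<in> \<rat>" "\<And>i j. b i j \<in> \<rat>" "\<And>i j. c i j \<in> \<rat>" "\<And>i j. d i j \<in> \<rat>"
      "\<And>i j. e i j \<in> \<rat>" "\<And>i j. f i j \<in> \<rat>"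
  shows "\<And>i j. i \<in> {1..3} \<Longrightarrow> j \<in> {1..3} \<Longrightarrow> c i j = c j i \<and> d i j = - d j i"
    and "\<And>x y. (\<And>i. x i \<in> \<rat>) \<Longrightarrow> (\<And>i. y i \<in> \<rat>) \<Longrightarrow>
      gqf_eval D 3 G (\<lambda>i. x i + y i * sqrt (of_int D)) =
      (\<Sum>i=1..3. \<Sum>j=1..3. (polar_coeff a i j + c i j) * x i * x j
         + of_int D * ((polar_coeff b i j - d i j) * x i * y j + (polar_coeff b i j + d i j) * y i * x j
         + (polar_coeff a i j - c i j) * y i * y j))"
proof -
  let ?s = "sqrt (of_int D)"
  define Re where "Re x y =
      (\<Sum>i=1..3. \<Sum>j=i..3. (a i j + e i j) * (x i * x j + of_int D * y i * y j)
          + of_int D * (b i j - f i j) * (x i * y j + y i * x j))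
      + (\<Sum>i=1..3. \<Sum>j=1..3. c i j * (x i * x j - of_int D * y i * y j)
          + of_int D * d i j * (y i * x j - x i * y j))" for x y
  define Im where "Im x y =
      (\<Sum>i=1..3. \<Sum>j=i..3. (b i j + f i j) * (x i * x j + of_int D * y i * y j)
          + (a i j - e i j) * (x i * y j + y i * x j))
        + (\<Sum>i=1..3. \<Sum>j=1..3. d i j * (x i * x j - of_int D * y i * y j)
          + c i j * (y i * x j - x i * y j))" for x y
  have eval: "gqf_eval D 3 G (\<lambda>i. x i + y i * ?s) = Re x y + Im x y * ?s"
    if "\<And>i. x i \<in> \<rat>" "\<And>i. y i \<in> \<rat>" for x y
    unfolding Re_def Im_def by (rule gqf_eval_parts[OF D coeffs that])
  have Im0: "Im (\<lambda>i. of_int (x i)) (\<lambda>i. of_int (y i)) = 0" for x y :: "nat \<Rightarrow> int"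
  proof -
    let ?x = "\<lambda>i. real_of_int (x i)" and ?y = "\<lambda>i. real_of_int (y i)"
    have mem: "?x i + ?y i * ?s \<in> quad_int D" for i
    proof -
      let ?p = "[:(?x i)\<^sup>2 - of_int D * (?y i)\<^sup>2, - 2 * ?x i, 1:]"
      have "\<forall>k. coeff ?p k \<in> \<int>"
        by (auto simp: coeff_pCons split: nat.splits)
      moreover have "poly ?p (?x i + ?y i * ?s) = 0"
        using D by (simp add: power2_eq_square algebra_simps)
      ultimately have "algebraic_int (?x i + ?y i * ?s)"
        by (intro algebraic_int.intros[of ?p]) auto
      then show ?thesis
        unfolding quad_int_def quad_field_def by (intro CollectI conjI exI[of _ "?x i"] exI[of _ "?y i"]) auto
    qed
    then have "gqf_eval D 3 G (\<lambda>i. ?x i + ?y i * ?s) \<in> \<int>"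
      using Z unfolding gqf_Z_valued_def by blast
    moreover have "Re ?x ?y \<in> \<rat>" "Im ?x ?y \<in> \<rat>"
      unfolding Re_def Im_def using rat
      by (auto intro!: Rats_add Rats_diff Rats_mult Rats_sum)
    moreover have "gqf_eval D 3 G (\<lambda>i. ?x i + ?y i * ?s) = Re ?x ?y + Im ?x ?y * ?s"
      by (rule eval) auto
    ultimately show ?thesis
      using sqrt_rat_independent(2)[OF D, of "Re ?x ?y - gqf_eval D 3 G (\<lambda>i. ?x i + ?y i * ?s)" "Im ?x ?y"]
        Ints_subset_Rats Rats_diff by (smt (verit) subsetD)
  qed
  \<comment> \<open>Points with coordinates 0 and 1 isolate the coefficients of the irrational
    part.\<close>
  let ?v = "\<lambda>p q r i. if i = 1 then p else if i = 2 then q else (r :: int)"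
  have I: "Im (\<lambda>i. of_int (?v x1 x2 x3 i)) (\<lambda>i. of_int (?v y1 y2 y3 i)) = 0" for x1 x2 x3 y1 y2 y3
    by (rule Im0)
  have Dn: "real_of_int D \<noteq> 0" using D by simp
  note ex = Im_def sum_1_3 sum_2_3
  note I' = I[unfolded ex]
  have diag: "b i i + f i i = 0 \<and> d i i = 0 \<and> a i i = e i i" if "i \<in> {1, 2, 3}" for i
  proof -
    have "b i i + f i i + d i i = 0"
      using that I'[of 1 0 0 0 0 0] I'[of 0 1 0 0 0 0] I'[of 0 0 1 0 0 0] by auto
    moreover have "of_int D * (b i i + f i i - d i i) = 0"
      using that I'[of 0 0 0 1 0 0] I'[of 0 0 0 0 1 0] I'[of 0 0 0 0 0 1] by (auto simp: algebra_simps)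
    then have "b i i + f i i - d i i = 0" using Dn by simp
    ultimately have *: "b i i + f i i = 0" "d i i = 0" by simp_all
    then have "2 * (a i i - e i i) = 0"
      using that I'[of 1 0 0 1 0 0] I'[of 0 1 0 0 1 0] I'[of 0 0 1 0 0 1] by auto
    with * show ?thesis by simp
  qed
  note diag' = diag[of 1, simplified] diag[of 2, simplified] diag[of 3, simplified]
  \<comment> \<open>The coefficients of x_i y_j and x_j y_i contain c_ij - c_ji with opposite signs,
    so their sum and difference separate it from a_ij - e_ij. Together with \<open>diag\<close> this
    says \<gamma>_ij = \<tau>(\<alpha>_ij) and \<beta>_ji = \<tau>(\<beta>_ij).\<close>
  have off: "b i j + f i j = 0 \<and> d i j = - d j i \<and> a i j = e i j \<and> c i j = c j i"
    if "(i, j) \<in> {(1, 2), (1, 3), (2, 3)}" for i j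
  proof -
    have "b i j + f i j + d i j + d j i = 0"
      using that diag' I'[of 1 1 0 0 0 0] I'[of 1 0 1 0 0 0] I'[of 0 1 1 0 0 0] by auto
    moreover have "of_int D * (b i j + f i j - d i j - d j i) = 0"
      using that diag' I'[of 0 0 0 1 1 0] I'[of 0 0 0 1 0 1] I'[of 0 0 0 0 1 1] by (auto simp: algebra_simps)
    then have "b i j + f i j - d i j - d j i = 0" using Dn by simp
    moreover have "a i j - e i j + c j i - c i j = 0"
      using that diag' I'[of 1 0 0 0 1 0] I'[of 1 0 0 0 0 1] I'[of 0 1 0 0 0 1] by (auto simp: algebra_simps)
    moreover have "a i j - e i j + c i j - c j i = 0"
      using that diag' I'[of 0 1 0 1 0 0] I'[of 0 0 1 1 0 0] I'[of 0 0 1 0 1 0] by (auto simp: algebra_simps)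
    ultimately show ?thesis by linarith
  qed
  have set: "{1..3::nat} = {1, 2, 3}" by auto
  show "c i j = c j i \<and> d i j = - d j i" if "i \<in> {1..3}" "j \<in> {1..3}" for i j
    using that off[of 1 2] off[of 1 3] off[of 2 3] diag[of 1] diag[of 2] diag[of 3]
    unfolding set by auto
  show "gqf_eval D 3 G (\<lambda>i. x i + y i * sqrt (of_int D)) =
      (\<Sum>i=1..3. \<Sum>j=1..3. (polar_coeff a i j + c i j) * x i * x j
         + of_int D * ((polar_coeff b i j - d i j) * x i * y j + (polar_coeff b i j + d i j) * y i * x j
         + (polar_coeff a i j - c i j) * y i * y j))"
    if "\<And>i. x i \<in> \<rat>" "\<And>i. y i \<in> \<rat>" for x y
  proof -
    have "Im x y = 0"
      unfolding ex using diag' off[of 1 2] off[of 1 3] off[of 2 3] by (simp add: algebra_simps)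
    have e: "e 1 1 = a 1 1" "e 2 2 = a 2 2" "e 3 3 = a 3 3" "e 1 2 = a 1 2" "e 1 3 = a 1 3" "e 2 3 = a 2 3"
      and f: "f 1 1 = - b 1 1" "f 2 2 = - b 2 2" "f 3 3 = - b 3 3"
        "f 1 2 = - b 1 2" "f 1 3 = - b 1 3" "f 2 3 = - b 2 3"
      and cd: "c 2 1 = c 1 2" "c 3 1 = c 1 3" "c 3 2 = c 2 3"
        "d 2 1 = - d 1 2" "d 3 1 = - d 1 3" "d 3 2 = - d 2 3" "d 1 1 = 0" "d 2 2 = 0" "d 3 3 = 0"
      using diag' off[of 1 2] off[of 1 3] off[of 2 3] by simp_all
    show ?thesis
      unfolding eval[OF that] \<open>Im x y = 0\<close> Re_def sum_1_3 sum_2_3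
      by (simp add: polar_coeff_def e f cd algebra_simps del: One_nat_def)
  qed
qed

section \<open>The bilinear form on six integer coordinates\<close>

text \<open>The bilinear form of x + y sqrt D and x' + y' sqrt D. Its Gram matrix has the blocks A
  and D U in the upper row, D U^T and D C in the lower one.\<close>

definition split_form ::
    "int \<Rightarrow> (nat \<Rightarrow> nat \<Rightarrow> int) \<Rightarrow> (nat \<Rightarrow> nat \<Rightarrow> int) \<Rightarrow> (nat \<Rightarrow> nat \<Rightarrow> int) \<Rightarrow>
      (nat \<Rightarrow> int) \<Rightarrow> (nat \<Rightarrow> int) \<Rightarrow> (nat \<Rightarrow> int) \<Rightarrow> (nat \<Rightarrow> int) \<Rightarrow> int" where
  "split_form D A U C x y x' y' = (\<Sum>i=1..3. \<Sum>j=1..3. A i j * x i * x' j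
      + D * (U i j * x i * y' j + U j i * y i * x' j + C i j * y i * y' j))"

lemma split_form_sym:
  assumes "\<And>i j. i \<in> {1..3} \<Longrightarrow> j \<in> {1..3} \<Longrightarrow> A i j = A j i"
    "\<And>i j. i \<in> {1..3} \<Longrightarrow> j \<in> {1..3} \<Longrightarrow> C i j = C j i"
  shows "split_form D A U C x y x' y' = split_form D A U C x' y' x y"
  unfolding split_form_def
  by (subst sum.swap) (auto intro!: sum.cong simp: assms algebra_simps)

lemma split_form_lin:
  "split_form D A U C (\<lambda>i. k * x i + l * u i) (\<lambda>i. k * y i + l * v i) x' y' =
     k * split_form D A U C x y x' y' + l * split_form D A U C u v x' y'"
  unfolding split_form_def sum_distrib_left sum.distrib[symmetric]
  by (intro sum.cong refl) (simp add: algebra_simps)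

text \<open>Modulo \<open>D\<close> only the three coordinates in \<open>x\<close> survive on the
  left; the inner sums are the three linear forms needed for the rank bound.\<close>

lemma cong_split_form:
  "[split_form D A U C x y x' y' = (\<Sum>i=1..3. x i * (\<Sum>j=1..3. A i j * x' j))] (mod D)"
proof -
  have "split_form D A U C x y x' y' = (\<Sum>i=1..3. x i * (\<Sum>j=1..3. A i j * x' j))
      + D * (\<Sum>i=1..3. \<Sum>j=1..3. U i j * x i * y' j + U j i * y i * x' j + C i j * y i * y' j)"
    unfolding split_form_def sum_distrib_left sum.distrib[symmetric]
    by (intro sum.cong refl) (simp add: algebra_simps)
  then show ?thesis by (simp add: cong_iff_dvd_diff)
qed

text \<open>The vectors (p, q) are coordinates in an integral basis, and the form on numerators is
  \<open>k\<close> times the form to be escalated.\<close>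

lemma split_form_escalation:
  fixes D k r t :: int
  assumes D: "D > 62" "squarefree D" and k: "k > 0" "coprime k D"
    and sym: "\<And>i j. i \<in> {1..3} \<Longrightarrow> j \<in> {1..3} \<Longrightarrow> A i j = A j i"
      "\<And>i j. i \<in> {1..3} \<Longrightarrow> j \<in> {1..3} \<Longrightarrow> C i j = C j i"
    and dvd: "\<And>p q p' q'. k dvd
      split_form D A U C (\<lambda>i. r * p i + t * q i) q (\<lambda>i. r * p' i + t * q' i) q'"
    and nonneg: "\<And>p q. 0 \<le>
      split_form D A U C (\<lambda>i. r * p i + t * q i) q (\<lambda>i. r * p i + t * q i) q"
    and univ: "\<And>m. m > 0 \<Longrightarrow> \<exists>p q.
      split_form D A U C (\<lambda>i. r * p i + t * q i) q (\<lambda>i. r * p i + t * q i) q = k * m"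
  shows "D \<in> {66, 70, 74, 77, 78, 82, 85, 86, 87, 93, 94, 95, 102, 106, 110}"
proof -
  define X :: "(nat \<Rightarrow> int) \<times> (nat \<Rightarrow> int) \<Rightarrow> nat \<Rightarrow> int"
    where "X = (\<lambda>(p, q) i. r * p i + t * q i)"
  define T where "T u v = split_form D A U C (X u) (snd u) (X v) (snd v)" for u v
  define B where "B u v = T u v div k" for u v
  define lin :: "int \<Rightarrow> (nat \<Rightarrow> int) \<times> (nat \<Rightarrow> int) \<Rightarrow> int \<Rightarrow> (nat \<Rightarrow> int) \<times> (nat \<Rightarrow> int) \<Rightarrow> _"
    where "lin m u l v = (\<lambda>i. m * fst u i + l * fst v i, \<lambda>i. m * snd u i + l * snd v i)" for m u l v
  have "k dvd T u v" for u v
    unfolding T_def X_def using dvd[of "fst u" "snd u" "fst v" "snd v"] by (simp add: case_prod_beta)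
  then have T: "T u v = k * B u v" for u v by (simp add: B_def)
  have T_sym: "T u v = T v u" for u v
    unfolding T_def by (rule split_form_sym) (fact sym)+
  have T_lin: "T (lin m u l v) w = m * T u w + l * T v w" for m u l v w
  proof -
    have "X (lin m u l v) = (\<lambda>i. m * X u i + l * X v i)"
      by (auto simp: X_def lin_def case_prod_beta algebra_simps)
    then show ?thesis
      unfolding T_def using split_form_lin by (simp add: lin_def)
  qed
  interpret escalation D B lin
  proof
    show B_sym: "B u v = B v u" for u v
      using T_sym[of u v] k by (simp add: T)
    show "B (lin m u l v) w = m * B u w + l * B v w" for m u l v w
    proof -
      have "k * B (lin m u l v) w = k * (m * B u w + l * B v w)"
        using T_lin[of m u l v w] by (simp add: T algebra_simps)
      then show ?thesis using k by simp
    qed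
    show "B u u \<ge> 0" for u
      using nonneg[of "fst u" "snd u"] T[of u u] k
      by (simp add: T_def X_def case_prod_beta zero_le_mult_iff)
    show "\<exists>u. B u u = m" if pos: "m > 0" for m
    proof -
      obtain p q where "T (p, q) (p, q) = k * m"
        using univ[OF pos] by (auto simp: T_def X_def)
      then show ?thesis using T k by auto
    qed
    fix u v w x
    assume "B u v = 0" "B u w = 0"
    then have "T u v = 0" "T u w = 0" by (simp_all add: T)
    then have "D dvd T u u * (T v v * T w w * T x x + 2 * T v w * T v x * T w x - T v v * (T w x)\<^sup>2
              - T w w * (T v x)\<^sup>2 - T x x * (T v w)\<^sup>2)
            - (T u x)\<^sup>2 * (T v v * T w w - (T v w)\<^sup>2)"
      using T_sym cong_split_form
      by (intro dvd_gram_det[where X = X and W = "\<lambda>i v. \<Sum>j=1..3. A i j * X v j"]) (auto simp: T_def)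
    \<comment> \<open>Each of the four rows of the Gram determinant contributes a factor
      \<open>k\<close>, which cancels because it is prime to \<open>D\<close>.\<close>
    also have "\<dots> = k ^ 4 * (B u u * (B v v * B w w * B x x + 2 * B v w * B v x * B w x
              - B v v * (B w x)\<^sup>2 - B w w * (B v x)\<^sup>2 - B x x * (B v w)\<^sup>2)
            - (B u x)\<^sup>2 * (B v v * B w w - (B v w)\<^sup>2))"
      unfolding T by (simp add: power2_eq_square power4_eq_xxxx algebra_simps)
    finally show "D dvd B u u * (B v v * B w w * B x x + 2 * B v w * B v x * B w x
              - B v v * (B w x)\<^sup>2 - B w w * (B v x)\<^sup>2 - B x x * (B v w)\<^sup>2)
            - (B u x)\<^sup>2 * (B v v * B w w - (B v w)\<^sup>2)"
      using k(2) by (subst (asm) coprime_dvd_mult_right_iff) (auto simp: coprime_commute)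
  qed
  show ?thesis using D_in_list[OF D] .
qed

lemma gqf_eval_nonneg:
  assumes "D \<ge> 2" "squarefree D" "gqf_pos_def D n G" "z \<in> {1..n} \<rightarrow> quad_field D"
  shows "gqf_eval D n G z \<ge> 0"
proof (cases "\<exists>i\<in>{1..n}. z i \<noteq> 0")
  case True
  then show ?thesis using assms unfolding gqf_pos_def_def by fastforce
next
  case False
  then have "gqf_eval D n G z = gqf_eval D n G (\<lambda>_. 0)"
    by (intro gqf_eval_cong) auto
  also have "quad_conj D 0 = 0" using quad_conj_eq[OF assms(1,2), of 0 0] by simp
  then have "gqf_eval D n G (\<lambda>_. 0) = 0" by (simp add: gqf_eval_def)
  finally show ?thesis by simp
qed

text \<open>
  The parameters \<open>(\<mu>, r, t)\<close> describe the elements of \<open>\<O>\<^sub>K\<close> as \<open>(r p + t q + q \<surd>D) / \<mu>\<close>; they are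
  \<open>(1, 1, 0)\<close> for \<open>D \<equiv> 2, 3\<close> and \<open>(2, 2, 1)\<close> for \<open>D \<equiv> 1\<close> modulo 4.
\<close>

lemma D_in_list_if_normal_form:
  fixes D r t \<mu> :: int and a b c d :: "nat \<Rightarrow> nat \<Rightarrow> int"
  assumes D: "D > 62" "squarefree D" and \<mu>: "\<mu> > 0" "coprime \<mu> D"
    and G: "gqf_Z_universal D 3 G"
    and sym: "\<And>i j. i \<in> {1..3} \<Longrightarrow> j \<in> {1..3} \<Longrightarrow> a i j = a j i \<and> b i j = b j i \<and> c i j = c j i \<and> d i j = - d j i"
    and eval: "\<And>x y. (\<And>i. x i \<in> \<rat>) \<Longrightarrow> (\<And>i. y i \<in> \<rat>) \<Longrightarrow>
      gqf_eval D 3 G (\<lambda>i. x i + y i * sqrt (of_int D)) =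
      (\<Sum>i=1..3. \<Sum>j=1..3. of_int (a i j + c i j) * x i * x j
         + of_int D * (of_int (b i j - d i j) * x i * y j + of_int (b i j + d i j) * y i * x j
         + of_int (a i j - c i j) * y i * y j))"
    and int: "\<And>z. z \<in> quad_int D \<Longrightarrow> \<exists>p q :: int. z = (of_int (r * p + t * q) + of_int q * sqrt (of_int D)) / of_int \<mu>"
    and dvd: "\<And>i j p q p' q'. i \<in> {1..3} \<Longrightarrow> j \<in> {1..3} \<Longrightarrow> \<mu>\<^sup>2 dvd
       (a i j + c i j) * (r * p + t * q) * (r * p' + t * q')
       + D * ((b i j - d i j) * (r * p + t * q) * q' + (b i j + d i j) * q * (r * p' + t * q')
         + (a i j - c i j) * q * q')"
  shows "D \<in> {66, 70, 74, 77, 78, 82, 85, 86, 87, 93, 94, 95, 102, 106, 110}"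
proof -
  let ?s = "sqrt (of_int D)"
  let ?A = "\<lambda>i j. a i j + c i j" and ?U = "\<lambda>i j. b i j - d i j" and ?C = "\<lambda>i j. a i j - c i j"
  have D2: "D \<ge> 2" using D by simp
  have U: "b j i - d j i = b i j + d i j" if "i \<in> {1..3}" "j \<in> {1..3}" for i j
    using sym[OF that] by simp
  have scaled_eval: "gqf_eval D 3 G (\<lambda>i. (of_int (x i) + of_int (y i) * ?s) / of_int \<mu>) * of_int (\<mu>\<^sup>2) =
      of_int (split_form D ?A ?U ?C x y x y)" for x y
  proof -
    have "gqf_eval D 3 G (\<lambda>i. (of_int (x i) + of_int (y i) * ?s) / of_int \<mu>) =
        gqf_eval D 3 G (\<lambda>i. of_int (x i) / of_int \<mu> + of_int (y i) / of_int \<mu> * ?s)"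
      by (simp add: add_divide_distrib)
    also have "\<dots> = (\<Sum>i=1..3. \<Sum>j=1..3. of_int (a i j + c i j) * (of_int (x i) / of_int \<mu>) * (of_int (x j) / of_int \<mu>)
         + of_int D * (of_int (b i j - d i j) * (of_int (x i) / of_int \<mu>) * (of_int (y j) / of_int \<mu>)
         + of_int (b i j + d i j) * (of_int (y i) / of_int \<mu>) * (of_int (x j) / of_int \<mu>)
         + of_int (a i j - c i j) * (of_int (y i) / of_int \<mu>) * (of_int (y j) / of_int \<mu>)))"
      by (rule eval) auto
    finally have "gqf_eval D 3 G (\<lambda>i. (of_int (x i) + of_int (y i) * ?s) / of_int \<mu>) * of_int (\<mu>\<^sup>2) = \<dots> * of_int (\<mu>\<^sup>2)"
      by (rule arg_cong)
    also have "\<dots> = (\<Sum>i=1..3. \<Sum>j=1..3. of_int ((a i j + c i j) * x i * x j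
         + D * ((b i j - d i j) * x i * y j + (b i j + d i j) * y i * x j + (a i j - c i j) * y i * y j)))"
      unfolding sum_distrib_right using \<mu>(1)
      by (intro sum.cong refl) (simp add: power2_eq_square field_simps)
    also have "\<dots> = of_int (split_form D ?A ?U ?C x y x y)"
      unfolding split_form_def of_int_sum by (intro sum.cong refl) (simp only: U)
    finally show ?thesis .
  qed
  show ?thesis
  proof (rule split_form_escalation[where k = "\<mu>\<^sup>2" and r = r and t = t and A = ?A and U = ?U and C = ?C])
    show "\<mu>\<^sup>2 dvd split_form D ?A ?U ?C (\<lambda>i. r * p i + t * q i) q (\<lambda>i. r * p' i + t * q' i) q'"
      for p q p' q'
      unfolding split_form_def by (intro dvd_sum) (use dvd U in simp)
    show "0 \<le> split_form D ?A ?U ?C (\<lambda>i. r * p i + t * q i) q (\<lambda>i. r * p i + t * q i) q" for p q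
    proof -
      have "(of_int (r * p i + t * q i) + of_int (q i) * ?s) / of_int \<mu> \<in> quad_field D" for i
        unfolding quad_field_def
        by (intro CollectI exI[of _ "of_int (r * p i + t * q i) / of_int \<mu>"]
            exI[of _ "of_int (q i) / of_int \<mu>"]) (auto simp: add_divide_distrib)
      then have "0 \<le> gqf_eval D 3 G (\<lambda>i. (of_int (r * p i + t * q i) + of_int (q i) * ?s) / of_int \<mu>)"
        using G by (intro gqf_eval_nonneg[OF D2 D(2)] Pi_I) (simp_all add: gqf_Z_universal_def)
      then have "0 \<le> real_of_int (split_form D ?A ?U ?C (\<lambda>i. r * p i + t * q i) q (\<lambda>i. r * p i + t * q i) q)"
        unfolding scaled_eval[symmetric] by simp
      then show ?thesis by simp
    qed
    show "\<exists>p q. split_form D ?A ?U ?C (\<lambda>i. r * p i + t * q i) q (\<lambda>i. r * p i + t * q i) q = \<mu>\<^sup>2 * m"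
      if pos: "m > 0" for m
    proof -
      obtain z where z: "z \<in> {1..3} \<rightarrow> quad_int D" "gqf_eval D 3 G z = of_int m"
        using G pos unfolding gqf_Z_universal_def by blast
      then have "\<forall>i\<in>{1..3}. \<exists>p q :: int. z i = (of_int (r * p + t * q) + of_int q * ?s) / of_int \<mu>"
        using int by blast
      then obtain p q :: "nat \<Rightarrow> int" where pq:
          "\<forall>i\<in>{1..3}. z i = (of_int (r * p i + t * q i) + of_int (q i) * ?s) / of_int \<mu>"
        by metis
      have "gqf_eval D 3 G z = gqf_eval D 3 G (\<lambda>i. (of_int (r * p i + t * q i) + of_int (q i) * ?s) / of_int \<mu>)"
        using pq by (intro gqf_eval_cong) blast
      then have "real_of_int (split_form D ?A ?U ?C (\<lambda>i. r * p i + t * q i) q (\<lambda>i. r * p i + t * q i) q)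
          = of_int (\<mu>\<^sup>2 * m)"
        unfolding scaled_eval[symmetric] using z by (simp add: mult.commute)
      then show ?thesis by (simp only: of_int_eq_iff) blast
    qed
  qed (use D \<mu> sym in auto)
qed

section \<open>The residue classes of D modulo 4\<close>

lemma polar_coeff_of_int: "polar_coeff (\<lambda>i j. of_int (a i j)) i j = of_int (polar_coeff a i j)"
  by (simp add: polar_coeff_def)

lemma polar_coeff_sym: "polar_coeff a i j = polar_coeff a j i"
  by (simp add: polar_coeff_def)

lemma choose_pairs:
  assumes "\<forall>i\<in>I. \<forall>j\<in>J i. \<exists>m n. Q i j m n"
  obtains a b where "\<forall>i\<in>I. \<forall>j\<in>J i. Q i j (a i j) (b i j)"
proof -
  define w where "w i j = (SOME (m, n). Q i j m n)" for i j
  have "case_prod (Q i j) (w i j)" if "i \<in> I" "j \<in> J i" for i j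
    unfolding w_def using assms that by (intro someI_ex[of "case_prod (Q i j)"]) auto
  then show ?thesis
    using that[of "\<lambda>i j. fst (w i j)" "\<lambda>i j. snd (w i j)"] by (simp add: case_prod_beta)
qed

text \<open>Here the ring of integers is Z[sqrt D]: integral coefficients have integral parts, and
  divisibility by \<mu>^2 = 1 is vacuous.\<close>

lemma D_in_list_mod_4_eq_2_3:
  assumes D: "D > 62" "squarefree D" "D mod 4 = 2 \<or> D mod 4 = 3" and G: "gqf_Z_universal D 3 G"
  shows "D \<in> {66, 70, 74, 77, 78, 82, 85, 86, 87, 93, 94, 95, 102, 106, 110}"
proof -
  let ?s = "sqrt (of_int D)"
  have D2: "D \<ge> 2" using D by simp
  have coeffs: "i \<in> {1..3} \<Longrightarrow> j \<in> {i..3} \<Longrightarrow> gqf_\<alpha> G i j \<in> quad_int D \<and> gqf_\<gamma> G i j \<in> quad_int D"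
    "i \<in> {1..3} \<Longrightarrow> j \<in> {1..3} \<Longrightarrow> gqf_\<beta> G i j \<in> quad_int D" for i j
    using G unfolding gqf_Z_universal_def gqf_integral_def gqf_coeffs_in_def by blast+
  note int = quad_int_2_3[OF D2 D(2,3)]
  obtain a b where \<alpha>: "\<forall>i\<in>{1..3}. \<forall>j\<in>{i..3}.
      gqf_\<alpha> G i j = of_int (a i j) + of_int (b i j) * ?s"
    by (rule choose_pairs[of "{1..3}" "\<lambda>i. {i..3}"
          "\<lambda>i j m n. gqf_\<alpha> G i j = of_int m + of_int n * ?s"]) (use coeffs(1) int in blast)+
  obtain c d where \<beta>: "\<forall>i\<in>{1..3}. \<forall>j\<in>{1..3}.
      gqf_\<beta> G i j = of_int (c i j) + of_int (d i j) * ?s"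
    by (rule choose_pairs[of "{1..3}" "\<lambda>_. {1..3}"
          "\<lambda>i j m n. gqf_\<beta> G i j = of_int m + of_int n * ?s"]) (use coeffs(2) int in blast)+
  obtain e f where \<gamma>: "\<forall>i\<in>{1..3}. \<forall>j\<in>{i..3}.
      gqf_\<gamma> G i j = of_int (e i j) + of_int (f i j) * ?s"
    by (rule choose_pairs[of "{1..3}" "\<lambda>i. {i..3}"
          "\<lambda>i j m n. gqf_\<gamma> G i j = of_int m + of_int n * ?s"]) (use coeffs(1) int in blast)+
  have Z: "gqf_Z_valued D 3 G" using G unfolding gqf_Z_universal_def by blast
  note nf = ternary_normal_form[OF D2 D(2) Z \<alpha> \<beta> \<gamma> Rats_of_int Rats_of_int Rats_of_int Rats_of_int Rats_of_int Rats_of_int]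
  show ?thesis
  proof (rule D_in_list_if_normal_form[where \<mu> = 1 and r = 1 and t = 0 and G = G
        and a = "polar_coeff a" and b = "polar_coeff b" and c = c and d = d])
    show "polar_coeff a i j = polar_coeff a j i \<and> polar_coeff b i j = polar_coeff b j i \<and>
        c i j = c j i \<and> d i j = - d j i" if "i \<in> {1..3}" "j \<in> {1..3}" for i j
    proof -
      have "real_of_int (c i j) = of_int (c j i)" "real_of_int (d i j) = of_int (- d j i)"
        using nf(1)[OF that] by simp_all
      then show ?thesis by (simp only: of_int_eq_iff polar_coeff_sym[of _ i j])
    qed
    show "\<exists>p q :: int. z = (of_int (1 * p + 0 * q) + of_int q * ?s) / of_int 1" if "z \<in> quad_int D" for z
      using int[OF that] by simp
  qed (use D G nf(2) in \<open>auto simp: polar_coeff_of_int\<close>)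
qed

text \<open>By parity \<eta> = (a + b sqrt D)/2 and \<theta> = (c + d sqrt D)/2 are integers of the
  field, as are z = (2p + q + q sqrt D)/2 and likewise z'. The expression is 4 (Tr(\<eta> z z') +
  Tr(\<theta> z \<tau>(z'))), and traces of integers are integers.\<close>

lemma four_dvd_if_parity:
  fixes D a b c d :: int
  assumes "D mod 4 = 1" "even a \<longleftrightarrow> even b" "even c \<longleftrightarrow> even d"
  shows "4 dvd (a + c) * (2 * p + q) * (2 * p' + q')
     + D * ((b - d) * (2 * p + q) * q' + (b + d) * q * (2 * p' + q') + (a - c) * q * q')"
proof -
  have "even (a - b)" "even (c - d)" using assms by auto
  then obtain u v where "a - b = 2 * u" "c - d = 2 * v" by (meson evenE)
  then have uv: "a = b + 2 * u" "c = d + 2 * v" by auto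
  obtain w where w: "D = 4 * w + 1"
    using assms(1) by (metis mult_div_mod_eq)
  have "(a + c) * (2 * p + q) * (2 * p' + q')
     + D * ((b - d) * (2 * p + q) * q' + (b + d) * q * (2 * p' + q') + (a - c) * q * q') =
     4 * ((a + c) * p * p' + p * q' * (b + u + v + 2 * w * (b - d))
       + q * p' * (b + d + u + v + 2 * w * (b + d)) + q * q' * (b + u + w * (3 * b + 2 * u - d - 2 * v)))"
    unfolding uv w by (simp add: algebra_simps)
  then show ?thesis by simp
qed

lemma D_in_list_mod_4_eq_1:
  assumes D: "D > 62" "squarefree D" "D mod 4 = 1"
    and G: "gqf_classical D 3 G" "gqf_Z_universal D 3 G"
  shows "D \<in> {66, 70, 74, 77, 78, 82, 85, 86, 87, 93, 94, 95, 102, 106, 110}"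
proof -
  let ?s = "sqrt (of_int D)"
  have D2: "D \<ge> 2" using D by simp
  note int = quad_int_1[OF D2 D(2,3)]
  have twice: "\<exists>m n :: int. z = of_int m + of_int n * ?s \<and> (even m \<longleftrightarrow> even n)"
    if z: "z \<in> (*) 2 ` quad_int D" for z
  proof -
    obtain z' where "z = 2 * z'" "z' \<in> quad_int D" using z by blast
    moreover from this obtain m n :: int where
        "z' = (of_int m + of_int n * ?s) / 2" "even m \<longleftrightarrow> even n"
      using int by blast
    ultimately have "z = of_int m + of_int n * ?s \<and> (even m \<longleftrightarrow> even n)" by simp
    then show ?thesis by blast
  qed
  have \<alpha>\<gamma>: "\<exists>m n :: int. z = of_int m / (if i = j then 2 else 1) + of_int n / (if i = j then 2 else 1) * ?s
      \<and> (even m \<longleftrightarrow> even n)"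
    if "i \<in> {1..3}" "j \<in> {i..3}" "z = gqf_\<alpha> G i j \<or> z = gqf_\<gamma> G i j" for z i j
  proof (cases "i = j")
    case True
    then have "z \<in> quad_int D"
      using G that unfolding gqf_Z_universal_def gqf_integral_def gqf_coeffs_in_def by auto
    then show ?thesis using int True by (simp add: add_divide_distrib)
  next
    case False
    then have "z \<in> (*) 2 ` quad_int D"
      using G that unfolding gqf_classical_def by auto
    then show ?thesis using twice False by simp
  qed
  have \<beta>': "gqf_\<beta> G i j \<in> (*) 2 ` quad_int D" if "i \<in> {1..3}" "j \<in> {1..3}" for i j
    using G that unfolding gqf_classical_def by blast
  \<comment> \<open>Diagonal coefficients may have denominator 2, which the doubling in
    \<open>polar_coeff\<close> cancels. Off the diagonal the coefficients are twice integers of the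
    field, so they have none.\<close>
  define h :: "nat \<Rightarrow> nat \<Rightarrow> real" where "h i j = (if i = j then 2 else 1)" for i j
  obtain a b where \<alpha>: "\<forall>i\<in>{1..3}. \<forall>j\<in>{i..3}.
      gqf_\<alpha> G i j = of_int (a i j) / h i j + of_int (b i j) / h i j * ?s \<and> (even (a i j) \<longleftrightarrow> even (b i j))"
    by (rule choose_pairs[of "{1..3}" "\<lambda>i. {i..3}"
          "\<lambda>i j m n. gqf_\<alpha> G i j = of_int m / h i j + of_int n / h i j * ?s \<and> (even m \<longleftrightarrow> even n)"])
       (use \<alpha>\<gamma>[folded h_def] in blast)+
  obtain e f where \<gamma>: "\<forall>i\<in>{1..3}. \<forall>j\<in>{i..3}.
      gqf_\<gamma> G i j = of_int (e i j) / h i j + of_int (f i j) / h i j * ?s \<and> (even (e i j) \<longleftrightarrow> even (f i j))"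
    by (rule choose_pairs[of "{1..3}" "\<lambda>i. {i..3}"
          "\<lambda>i j m n. gqf_\<gamma> G i j = of_int m / h i j + of_int n / h i j * ?s \<and> (even m \<longleftrightarrow> even n)"])
       (use \<alpha>\<gamma>[folded h_def] in blast)+
  obtain c d where \<beta>: "\<forall>i\<in>{1..3}. \<forall>j\<in>{1..3}.
      gqf_\<beta> G i j = of_int (c i j) + of_int (d i j) * ?s \<and> (even (c i j) \<longleftrightarrow> even (d i j))"
    by (rule choose_pairs[of "{1..3}" "\<lambda>_. {1..3}"
          "\<lambda>i j m n. gqf_\<beta> G i j = of_int m + of_int n * ?s \<and> (even m \<longleftrightarrow> even n)"])
       (use twice[OF \<beta>'] in blast)+
  have eq: "\<forall>i\<in>{1..3}. \<forall>j\<in>{i..3}. gqf_\<alpha> G i j = of_int (a i j) / h i j + of_int (b i j) / h i j * ?s"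
    "\<forall>i\<in>{1..3}. \<forall>j\<in>{1..3}. gqf_\<beta> G i j = of_int (c i j) + of_int (d i j) * ?s"
    "\<forall>i\<in>{1..3}. \<forall>j\<in>{i..3}. gqf_\<gamma> G i j = of_int (e i j) / h i j + of_int (f i j) / h i j * ?s"
    using \<alpha> \<beta> \<gamma> by blast+
  have Z: "gqf_Z_valued D 3 G" using G unfolding gqf_Z_universal_def by blast
  have rat: "of_int m / h i j \<in> \<rat>" for m :: int and i j
    by (simp add: h_def)
  note nf = ternary_normal_form[OF D2 D(2) Z eq rat rat Rats_of_int Rats_of_int rat rat]
  \<comment> \<open>The symmetric extension of the numerators; it keeps their parity relations,
    which a further doubling of the diagonal would lose.\<close>
  define upper :: "(nat \<Rightarrow> nat \<Rightarrow> int) \<Rightarrow> nat \<Rightarrow> nat \<Rightarrow> int" where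
    "upper k i j = k (min i j) (max i j)" for k i j
  have polar: "polar_coeff (\<lambda>i j. of_int (k i j) / h i j) i j = of_int (upper k i j)" for k i j
    by (auto simp: polar_coeff_def h_def upper_def)
  show ?thesis
  proof (rule D_in_list_if_normal_form[where \<mu> = 2 and r = 2 and t = 1 and G = G
        and a = "upper a" and b = "upper b" and c = c and d = d])
    have "odd D" using D(3) by presburger
    then show "coprime 2 D" by simp
    show "upper a i j = upper a j i \<and> upper b i j = upper b j i \<and>
        c i j = c j i \<and> d i j = - d j i" if "i \<in> {1..3}" "j \<in> {1..3}" for i j
    proof -
      have "real_of_int (c i j) = of_int (c j i)" "real_of_int (d i j) = of_int (- d j i)"
        using nf(1)[OF that] by simp_all
      then show ?thesis by (simp only: of_int_eq_iff upper_def min.commute max.commute)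
    qed
    show "\<exists>p q :: int. z = (of_int (2 * p + 1 * q) + of_int q * ?s) / of_int 2" if zq: "z \<in> quad_int D" for z
    proof -
      obtain m n :: int where z: "z = (of_int m + of_int n * ?s) / 2" "even m \<longleftrightarrow> even n"
        using int[OF zq] by blast
      then have "even (m - n)" by simp
      then obtain p where "m - n = 2 * p" by (rule evenE)
      then have "m = 2 * p + 1 * n" by simp
      then show ?thesis using z by auto
    qed
    fix i j p q p' q'
    assume "i \<in> {1..3::nat}" "j \<in> {1..3::nat}"
    then show "2\<^sup>2 dvd (upper a i j + c i j) * (2 * p + 1 * q) * (2 * p' + 1 * q')
       + D * ((upper b i j - d i j) * (2 * p + 1 * q) * q' + (upper b i j + d i j) * q * (2 * p' + 1 * q')
         + (upper a i j - c i j) * q * q')"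
      using four_dvd_if_parity[OF D(3), of "upper a i j" "upper b i j" "c i j" "d i j" p q p' q']
        \<alpha>[rule_format, of "min i j" "max i j"] \<beta>[rule_format, of i j]
      by (simp add: upper_def min_def max_def split: if_splits)
  qed (use D G nf(2) in \<open>auto simp: polar\<close>)
qed

theorem theorem5p11:
  fixes D :: int
  assumes "D \<ge> 2" and "squarefree D"
    and "((D mod 4 = 2 \<or> D mod 4 = 3) \<and>
            (\<exists>G. gen_quad_form D 3 G \<and> gqf_Z_universal D 3 G)) \<or>
         (D mod 4 = 1 \<and>
            (\<exists>G. gen_quad_form D 3 G \<and> gqf_classical D 3 G \<and> gqf_Z_universal D 3 G))"
  shows "D \<in> {1..62} \<union> {66, 70, 74, 77, 78, 82, 85, 86, 87, 93, 94, 95, 102, 106, 110}"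
proof (cases "D \<le> 62")
  case True
  then show ?thesis using assms(1) by simp
next
  case False
  then have "D > 62" by simp
  then show ?thesis
    using assms(2,3) D_in_list_mod_4_eq_2_3 D_in_list_mod_4_eq_1 by blast
qed

end
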